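(* Let $P$ be an irreducible, positive recurrent stochastic matrix on a countable state space $\mathbb{E}$ with unique invariant probability measure $\pi$. Let $\tilde P$ be an irreducible stochastic matrix on $\mathbb{E}$, let $\tilde\Phi(n)$ be the discrete-time Markov chain with transition matrix $\tilde P$, and let $\Delta=\tilde P-P$. Let $i_0$ be any fixed state in $\mathbb{E}$. Suppose there are a finite function $V$ on $\mathbb{E}$ bounded away from zero (i.e. $\inf_{i\in\mathbb{E}}V(i)>0$) and positive constants $\lambda<1$, $b<\infty$ such that $$\sum_{j\in\mathbb{E}}P(i,j)V(j)\le \lambda V(i)+b\,I_{\{i_0\}}(i),\qquad i\in\mathbb{E}.$$ (i) Let $c=1+\|e\|_V\|\pi\|_V$. If $\|\Delta\|_V<\frac{1-\lambda}{c}$, then $\tilde\Phi(n)$ is positive recurrent and its unique invariant probability measure $\nu$ satisfies $$\|\nu-\pi\|_V\le \frac{c\,\|\pi\|_V\,\|\Delta\|_V}{1-\lambda-c\|\Delta\|_V}.$$ (ii) If $V\ge 1$ and $\|\Delta\|_V<\frac{(1-\lambda)^2}{b+1-\lambda}$, then $\tilde\Phi(n)$ is positive recurrent and its unique invariant probability measure $\nu$ satisfies $$\|\nu-\pi\|_V\le \frac{b(b+1-\lambda)\|\Delta\|_V}{(1-\lambda)^3-(1-\lambda)(b+1-\lambda)\|\Delta\|_V}.$$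
   Context: $e$ is the column vector of all ones and $I_{\{i_0\}}$ is the indicator function of $\{i_0\}$. For a function $V$ on $\mathbb{E}$ with $\inf V>0$, the $V$-norms are: for a (signed) measure $\mu$, $\|\mu\|_V=\sum_{i\in\mathbb{E}}|\mu(i)|V(i)$; for a column vector $x$, $\|x\|_V=\sup_{i\in\mathbb{E}}|x(i)|/V(i)$; for a matrix $L=(L_{ij})$ on $\mathbb{E}\times\mathbb{E}$, $\|L\|_V=\sup_{i\in\mathbb{E}}\frac{1}{V(i)}\sum_{j\in\mathbb{E}}|L_{ij}|V(j)$. *)

theory Defs
  imports "HOL-Probability.Probability"
begin

section \<open>Stochastic matrices\<close>

text \<open>
  The state space is a type of class \<open>countable\<close> (finite or countably infinite, nonempty).
\<close>

definition stochastic :: "('a::countable \<Rightarrow> 'a \<Rightarrow> real) \<Rightarrow> bool" where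
  "stochastic P \<longleftrightarrow> (\<forall>i j. 0 \<le> P i j) \<and> (\<forall>i. ((\<lambda>j. P i j) has_sum 1) UNIV)"

text \<open>The sum below converges whenever \<open>P\<close> is stochastic.\<close>

primrec matpow :: "('a::countable \<Rightarrow> 'a \<Rightarrow> real) \<Rightarrow> nat \<Rightarrow> 'a \<Rightarrow> 'a \<Rightarrow> real" where
  "matpow P 0 = (\<lambda>i j. if i = j then 1 else 0)"
| "matpow P (Suc n) = (\<lambda>i j. \<Sum>\<^sub>\<infinity>k. P i k * matpow P n k j)"

definition irreducible_matrix :: "('a::countable \<Rightarrow> 'a \<Rightarrow> real) \<Rightarrow> bool" where
  "irreducible_matrix P \<longleftrightarrow> (\<forall>i j. \<exists>n. 0 < matpow P n i j)"

definition invariant_prob :: "('a::countable \<Rightarrow> 'a \<Rightarrow> real) \<Rightarrow> ('a \<Rightarrow> real) \<Rightarrow> bool" where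
  "invariant_prob P \<mu> \<longleftrightarrow>
     (\<forall>i. 0 \<le> \<mu> i) \<and> (\<mu> has_sum 1) UNIV \<and> (\<forall>j. ((\<lambda>i. \<mu> i * P i j) has_sum \<mu> j) UNIV)"

definition unique_invariant_prob :: "('a::countable \<Rightarrow> 'a \<Rightarrow> real) \<Rightarrow> ('a \<Rightarrow> real) \<Rightarrow> bool" where
  "unique_invariant_prob P \<mu> \<longleftrightarrow>
     invariant_prob P \<mu> \<and> (\<forall>\<mu>'. invariant_prob P \<mu>' \<longrightarrow> \<mu>' = \<mu>)"

section \<open>The Markov chain of a stochastic matrix and positive recurrence\<close>

definition row_measure :: "('a::countable \<Rightarrow> 'a \<Rightarrow> real) \<Rightarrow> 'a \<Rightarrow> 'a measure" where
  "row_measure P i = density (count_space UNIV) (\<lambda>j. ennreal (P i j))"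

definition chain_kernel ::
    "('a::countable \<Rightarrow> 'a \<Rightarrow> real) \<Rightarrow> 'a \<Rightarrow> nat \<Rightarrow> (nat \<Rightarrow> 'a) \<Rightarrow> 'a measure" where
  "chain_kernel P i n \<omega> =
     (case n of 0 \<Rightarrow> return (count_space UNIV) i | Suc m \<Rightarrow> row_measure P (\<omega> m))"

text \<open>
  \<open>chain_law P i\<close> is the law, on the path space \<open>nat \<Rightarrow> 'a\<close>, of the chain with transition matrix
  \<open>P\<close> started in \<open>i\<close>; it is the Ionescu-Tulcea measure of the one-step kernels. The chain itself
  is the coordinate process. See \<open>emeasure_chain_law\<close> below for the finite-dimensional
  distributions.
\<close>

definition chain_law :: "('a::countable \<Rightarrow> 'a \<Rightarrow> real) \<Rightarrow> 'a \<Rightarrow> (nat \<Rightarrow> 'a) measure" where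
  "chain_law P i =
     projective_family.lim UNIV (Ionescu_Tulcea.CI (chain_kernel P i) (\<lambda>_. count_space UNIV))
       (\<lambda>_. count_space UNIV)"

text \<open>First return time to \<open>i\<close>; it is \<open>\<infinity>\<close> if the path never returns (infimum of the empty set).\<close>

definition return_time :: "'a \<Rightarrow> (nat \<Rightarrow> 'a) \<Rightarrow> enat" where
  "return_time i \<omega> = (INF n\<in>{n. 1 \<le> n \<and> \<omega> n = i}. enat n)"

text \<open>
  Finiteness of the mean return time includes recurrence, since paths that never return
  contribute \<open>\<infinity>\<close>.
\<close>

definition positive_recurrent :: "('a::countable \<Rightarrow> 'a \<Rightarrow> real) \<Rightarrow> bool" where
  "positive_recurrent P \<longleftrightarrow>
     (\<forall>i. (\<integral>\<^sup>+ \<omega>. ennreal_of_enat (return_time i \<omega>) \<partial>chain_law P i) < \<infinity>)"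

section \<open>The V-norms\<close>

text \<open>
  All three take values in \<open>[0,\<infinity>]\<close>; the sums of nonnegative extended reals always exist.
\<close>

definition meas_norm :: "('a::countable \<Rightarrow> real) \<Rightarrow> ('a \<Rightarrow> real) \<Rightarrow> ereal" where
  "meas_norm V \<mu> = (\<Sum>\<^sub>\<infinity>i. ereal (\<bar>\<mu> i\<bar> * V i))"

definition vec_norm :: "('a::countable \<Rightarrow> real) \<Rightarrow> ('a \<Rightarrow> real) \<Rightarrow> ereal" where
  "vec_norm V x = (SUP i. ereal (\<bar>x i\<bar> / V i))"

definition mat_norm :: "('a::countable \<Rightarrow> real) \<Rightarrow> ('a \<Rightarrow> 'a \<Rightarrow> real) \<Rightarrow> ereal" where
  "mat_norm V L = (SUP i. ereal (1 / V i) * (\<Sum>\<^sub>\<infinity>j. ereal (\<bar>L i j\<bar> * V j)))"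

section \<open>The path measure has the expected finite-dimensional distributions\<close>

lemma prob_space_row_measure:
  assumes "stochastic P"
  shows "prob_space (row_measure P i)"
proof
  have "(\<integral>\<^sup>+ j. ennreal (P i j) \<partial>count_space UNIV) = 1"
  proof -
    have s: "((\<lambda>j. P i j) has_sum 1) UNIV" and nn: "\<And>j. 0 \<le> P i j"
      using assms by (auto simp: stochastic_def)
    have "Infinite_Sum.abs_summable_on (P i) UNIV"
      using has_sum_imp_summable[OF s] nn by simp
    then have abs: "Infinite_Set_Sum.abs_summable_on (P i) UNIV"
      by (simp only: abs_summable_equivalent)
    then have int: "integrable (count_space UNIV) (P i)"
      by (simp add: abs_summable_on_def)
    have "(\<Sum>\<^sub>\<infinity>j. P i j) = infsetsum (P i) UNIV"
      using abs by (simp add: infsetsum_infsum)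
    then have "integral\<^sup>L (count_space UNIV) (P i) = 1"
      using infsumI[OF s] by (simp add: infsetsum_def)
    then show ?thesis
      using nn_integral_eq_integral[OF int] nn by simp
  qed
  then show "emeasure (row_measure P i) (space (row_measure P i)) = 1"
    by (simp add: row_measure_def emeasure_density)
qed

lemma sets_row_measure [simp, measurable_cong]:
  "sets (row_measure P i) = sets (count_space UNIV)"
  by (simp add: row_measure_def)

lemma Ionescu_Tulcea_chain:
  assumes "stochastic P"
  shows "Ionescu_Tulcea (chain_kernel P i) (\<lambda>_. count_space UNIV)"
proof (rule Ionescu_Tulcea.intro)
  have row: "row_measure P \<in> measurable (count_space UNIV) (subprob_algebra (count_space UNIV))"
    using prob_space_row_measure[OF assms]
    by (auto simp: space_subprob_algebra intro: prob_space_imp_subprob_space)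
  show "chain_kernel P i n \<in>
      measurable (PiM {0..<n} (\<lambda>_. count_space UNIV)) (subprob_algebra (count_space UNIV))" for n
  proof (cases n)
    case 0
    then show ?thesis
      by (auto simp: chain_kernel_def[abs_def] space_subprob_algebra
               intro!: measurable_const prob_space_imp_subprob_space prob_space_return)
  next
    case (Suc m)
    have "(\<lambda>\<omega>. \<omega> m) \<in> measurable (PiM {0..<Suc m} (\<lambda>_. count_space UNIV)) (count_space UNIV)"
      by (rule measurable_component_singleton) auto
    from measurable_compose[OF this row] show ?thesis
      by (simp add: Suc chain_kernel_def[abs_def])
  qed
  show "prob_space (chain_kernel P i n \<omega>)" for n \<omega>
    using prob_space_row_measure[OF assms]
    by (auto simp: chain_kernel_def prob_space_return split: nat.split)
qed

lemma sets_chain_law: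
  assumes "stochastic P"
  shows "sets (chain_law P i) = sets (PiM UNIV (\<lambda>_. count_space UNIV))"
proof -
  interpret IT: Ionescu_Tulcea "chain_kernel P i" "\<lambda>_. count_space UNIV"
    by (rule Ionescu_Tulcea_chain[OF assms])
  show ?thesis
    by (simp add: chain_law_def IT.PF.sets_lim)
qed

lemma measurable_return_time:
  fixes P :: "'a::countable \<Rightarrow> 'a \<Rightarrow> real"
  assumes "stochastic P"
  shows "(\<lambda>\<omega>. ennreal_of_enat (return_time j \<omega>)) \<in> borel_measurable (chain_law P i)"
proof -
  let ?S = "PiM UNIV (\<lambda>_::nat. count_space (UNIV :: 'a set))"
  have eq: "return_time j \<omega> = (if \<exists>n. 1 \<le> n \<and> \<omega> n = j then enat (LEAST n. 1 \<le> n \<and> \<omega> n = j) else \<infinity>)"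
    for \<omega> :: "nat \<Rightarrow> 'a"
  proof (cases "\<exists>n. 1 \<le> n \<and> \<omega> n = j")
    case True
    have L: "1 \<le> (LEAST n. 1 \<le> n \<and> \<omega> n = j) \<and> \<omega> (LEAST n. 1 \<le> n \<and> \<omega> n = j) = j"
      using True by (rule LeastI_ex)
    have "return_time j \<omega> = enat (LEAST n. 1 \<le> n \<and> \<omega> n = j)"
      unfolding return_time_def
    proof (rule antisym)
      show "(INF n\<in>{n. 1 \<le> n \<and> \<omega> n = j}. enat n) \<le> enat (LEAST n. 1 \<le> n \<and> \<omega> n = j)"
        using L by (intro INF_lower) (simp only: mem_Collect_eq)
      show "enat (LEAST n. 1 \<le> n \<and> \<omega> n = j) \<le> (INF n\<in>{n. 1 \<le> n \<and> \<omega> n = j}. enat n)"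
        by (intro INF_greatest) (simp add: Least_le)
    qed
    then show ?thesis
      using True by simp
  next
    case False
    then have "{n. 1 \<le> n \<and> \<omega> n = j} = {}"
      by blast
    then have "return_time j \<omega> = \<infinity>"
      unfolding return_time_def by (simp only: image_empty Inf_empty top_enat_def)
    then show ?thesis
      unfolding if_not_P[OF False] .
  qed
  have pred: "Measurable.pred ?S (\<lambda>\<omega>. 1 \<le> n \<and> \<omega> n = j)" for n
    by measurable
  have "return_time j \<in> measurable ?S (count_space UNIV)"
    unfolding eq[abs_def] using pred by measurable
  then have "(\<lambda>\<omega>. ennreal_of_enat (return_time j \<omega>)) \<in> borel_measurable ?S"
    by (rule measurable_compose) simp
  then show ?thesis
    unfolding measurable_cong_sets[OF sets_chain_law[OF assms] refl] .
qed

lemma emeasure_chain_law: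
  fixes x :: "nat \<Rightarrow> 'a::countable"
  assumes "stochastic P"
  shows "emeasure (chain_law P i) {\<omega>. \<forall>k\<le>n. \<omega> k = x k} =
    (if x 0 = i then ennreal (\<Prod>k<n. P (x k) (x (Suc k))) else 0)"
proof -
  let ?M = "\<lambda>_::nat. count_space (UNIV :: 'a set)"
  let ?u = "\<lambda>_::nat. undefined :: 'a"
  interpret IT: Ionescu_Tulcea "chain_kernel P i" ?M
    by (rule Ionescu_Tulcea_chain[OF assms])
  define X where "X n = (PiE {0..<Suc n} (\<lambda>k. {x k}))" for n
  have X_iff: "\<omega> \<in> X n \<longleftrightarrow> (\<forall>k\<le>n. \<omega> k = x k) \<and> (\<forall>k>n. \<omega> k = undefined)" for \<omega> n
    unfolding X_def PiE_iff extensional_def by (fastforce simp: less_Suc_eq_le not_le)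
  have X_sets [measurable]: "X n \<in> sets (PiM {0..<Suc n} ?M)" for n
    unfolding X_def by (intro sets_PiM_I_finite) auto
  have u: "?u \<in> space (PiM {0..<0} ?M)"
    by (simp add: space_PiM)
  have nn: "0 \<le> P a b" for a b
    using assms by (auto simp: stochastic_def)
  have C: "emeasure (IT.C 0 (Suc n) ?u) (X n) =
      (if x 0 = i then ennreal (\<Prod>k<n. P (x k) (x (Suc k))) else 0)" for n
  proof (induction n)
    case 0
    have "emeasure (IT.C 0 (Suc 0) ?u) (X 0) = emeasure (IT.eP 0 ?u) (X 0)"
      using bind_return[OF IT.measurable_eP[of 0] u] by simp
    also have "\<dots> = emeasure (return (count_space UNIV) i) ((\<lambda>a. ?u(0 := a)) -` X 0)"
      using IT.emeasure_eP[OF u X_sets] by (simp add: chain_kernel_def)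
    also have "(\<lambda>a. ?u(0 := a)) -` X 0 = {x 0}"
      by (rule set_eqI) (simp add: X_iff)
    finally show ?case
      by (simp add: indicator_def)
  next
    case (Suc n)
    define Q where "Q = IT.C 0 (Suc n) ?u"
    have sets_Q: "sets Q = sets (PiM {0..<Suc n} ?M)"
      unfolding Q_def IT.sets_C[OF u] add_0 ..
    have space_Q: "space Q = space (PiM {0..<Suc n} ?M)"
      using sets_Q by (rule sets_eq_imp_space_eq)
    have ne: "space Q \<noteq> {}"
      unfolding Q_def using IT.prob_space_C[OF u] by (rule prob_space.not_empty)
    have "IT.eP (Suc n) \<in> measurable Q (subprob_algebra (PiM {0..<Suc (Suc n)} ?M))"
      unfolding measurable_cong_sets[OF sets_Q refl] by (rule IT.measurable_eP)
    then have "emeasure (Q \<bind> IT.eP (Suc n)) (X (Suc n)) =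
        (\<integral>\<^sup>+ \<omega>. emeasure (IT.eP (Suc n) \<omega>) (X (Suc n)) \<partial>Q)"
      by (rule emeasure_bind[OF ne _ X_sets])
    then have "emeasure (IT.C 0 (Suc (Suc n)) ?u) (X (Suc n)) =
        (\<integral>\<^sup>+ \<omega>. emeasure (IT.eP (Suc n) \<omega>) (X (Suc n)) \<partial>Q)"
      unfolding IT.C.simps(2)[of 0 "Suc n"] add_0 Q_def .
    also have "\<dots> = (\<integral>\<^sup>+ \<omega>. ennreal (P (x n) (x (Suc n))) * indicator (X n) \<omega> \<partial>Q)"
    proof (rule nn_integral_cong)
      fix \<omega> assume "\<omega> \<in> space Q"
      then have w: "\<omega> \<in> space (PiM {0..<Suc n} ?M)"
        by (simp only: space_Q)
      then have ext: "\<omega> \<in> extensional {0..<Suc n}"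
        by (simp add: space_PiM PiE_def)
      have pre: "fun_upd \<omega> (Suc n) -` X (Suc n) = (if \<omega> \<in> X n then {x (Suc n)} else {})"
      proof (rule set_eqI)
        fix a
        have "\<omega> k = undefined" if "k > n" for k
          using ext that by (simp add: extensional_def)
        then show "a \<in> fun_upd \<omega> (Suc n) -` X (Suc n) \<longleftrightarrow>
            a \<in> (if \<omega> \<in> X n then {x (Suc n)} else {})"
          by (simp add: X_iff le_Suc_eq) metis
      qed
      have "\<omega> \<in> X n \<Longrightarrow> \<omega> n = x n"
        by (simp add: X_iff)
      then have k: "\<omega> \<in> X n \<Longrightarrow> chain_kernel P i (Suc n) \<omega> = row_measure P (x n)"
        by (simp add: chain_kernel_def)
      have "emeasure (row_measure P (x n)) {x (Suc n)} = ennreal (P (x n) (x (Suc n)))"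
        unfolding row_measure_def
        by (subst emeasure_density) (auto simp: nn_integral_indicator_singleton)
      then show "emeasure (IT.eP (Suc n) \<omega>) (X (Suc n)) =
          ennreal (P (x n) (x (Suc n))) * indicator (X n) \<omega>"
        unfolding IT.emeasure_eP[OF w X_sets] space_count_space Int_UNIV_right pre
        by (cases "\<omega> \<in> X n") (simp_all add: k)
    qed
    also have "\<dots> = ennreal (P (x n) (x (Suc n))) * emeasure Q (X n)"
    proof (rule nn_integral_cmult_indicator)
      show "X n \<in> sets Q"
        unfolding sets_Q by (rule X_sets)
    qed
    finally show ?case
      unfolding Suc.IH[folded Q_def]
      by (simp add: ennreal_mult'[symmetric] nn prod_nonneg mult.commute del: IT.C.simps)
  qed
  have "{\<omega>. \<forall>k\<le>n. \<omega> k = x k} = prod_emb UNIV ?M {0..<Suc n} (X n)"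
    by (auto simp: prod_emb_def X_def PiE_iff space_PiM less_Suc_eq_le)
  then have "emeasure (chain_law P i) {\<omega>. \<forall>k\<le>n. \<omega> k = x k} = emeasure (IT.CI {0..<Suc n}) (X n)"
    using IT.lim[of "{0..<Suc n}" "X n"] by (simp add: chain_law_def)
  also have "\<dots> = emeasure (IT.C 0 (Suc n) ?u) (X n)"
    using IT.emeasure_CI[of "{0..<Suc n}" "Suc n" "X n"] sets.sets_into_space[OF X_sets[of n]]
    by (simp add: prod_emb_id space_PiM del: IT.C.simps)
  finally show ?thesis
    by (simp add: C del: IT.C.simps)
qed

end

theory Submission
  imports Defs
begin

text \<open>
  Let \<open>\<pi>\<close> and \<open>\<nu>\<close> be the invariant probabilities of \<open>P\<close> and \<open>Pt\<close>, and put
  \<open>s = (\<nu> i0 - \<pi> i0) / \<pi> i0\<close> and \<open>\<rho> = \<nu> - (1 + s) \<pi>\<close>. Then \<open>\<rho> = \<rho> P + \<nu> \<Delta>\<close>, and since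
  \<open>\<rho> i0 = 0\<close> the row \<open>i0\<close> of \<open>P\<close>, the only one on which \<open>P V \<le> lam V\<close> may fail, does not
  contribute, so \<open>(1 - lam) \<parallel>\<rho>\<parallel> \<le> \<parallel>\<Delta>\<parallel> \<parallel>\<nu>\<parallel>\<close> in the \<open>V\<close>-norms. As \<open>\<rho>\<close> has total mass \<open>-s\<close>, we get
  \<open>\<bar>s\<bar> \<le> \<parallel>e\<parallel> \<parallel>\<rho>\<parallel>\<close>, hence \<open>\<parallel>\<nu> - \<pi>\<parallel> \<le> c \<parallel>\<rho>\<parallel>\<close>; with \<open>\<parallel>\<nu>\<parallel> \<le> \<parallel>\<pi>\<parallel> + \<parallel>\<nu> - \<pi>\<parallel>\<close> this gives (i).
  Part (ii) follows from \<open>\<parallel>e\<parallel> \<le> 1\<close> and \<open>\<parallel>\<pi>\<parallel> \<le> b / (1 - lam)\<close>.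

  The matrix \<open>Pt\<close> itself satisfies the drift condition, with \<open>lam + \<parallel>\<Delta>\<parallel> < 1\<close> in place of \<open>lam\<close>.
  Its invariant measure is the expected number of visits during an excursion from \<open>i0\<close>, which the
  drift condition makes \<open>V\<close>-finite, and Kac's formula turns an invariant probability into
  positive recurrence.
\<close>

section \<open>Sums over countable types\<close>

text \<open>Integration against counting measure in \<open>ennreal\<close>: every sum exists, so
  monotone convergence and exchange of sums require no summability side conditions.\<close>

abbreviation nnsum :: "('a \<Rightarrow> ennreal) \<Rightarrow> ennreal"
  where "nnsum f \<equiv> \<integral>\<^sup>+ i. f i \<partial>count_space UNIV"

lemma nnsum_swap:
  fixes f :: "'a::countable \<Rightarrow> 'b::countable \<Rightarrow> ennreal"
  shows "nnsum (\<lambda>i. nnsum (\<lambda>j. f i j)) = nnsum (\<lambda>j. nnsum (\<lambda>i. f i j))"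
  by (rule nn_integral_count_space_nn_integral) auto

lemma nnsum_add: "nnsum (\<lambda>i. f i + g i) = nnsum f + nnsum g"
  by (rule nn_integral_add) auto

lemma nnsum_cmult: "nnsum (\<lambda>i. c * f i) = c * nnsum f"
  by (rule nn_integral_cmult) auto

lemma nnsum_multc: "nnsum (\<lambda>i. f i * c) = nnsum f * c"
  by (rule nn_integral_multc) auto

lemma nnsum_mono: "(\<And>i. f i \<le> g i) \<Longrightarrow> nnsum f \<le> nnsum g"
  by (rule nn_integral_mono) auto

lemma nnsum_member_le: "f i \<le> nnsum f"
  using nn_integral_ge_point[of i UNIV f] by simp

lemma nnsum_split:
  fixes f :: "'a \<Rightarrow> ennreal"
  shows "nnsum f = f i + nnsum (\<lambda>k. if k = i then 0 else f k)"
proof -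
  have "nnsum f = nnsum (\<lambda>k. f i * indicator {i} k + (if k = i then 0 else f k))"
    by (rule nn_integral_cong) (auto simp: indicator_def)
  also have "\<dots> = f i + nnsum (\<lambda>k. if k = i then 0 else f k)"
    by (simp add: nnsum_add nnsum_cmult)
  finally show ?thesis .
qed

section \<open>Comparison of \<open>nnsum\<close> with \<open>has_sum\<close> and with extended-real
  sums\<close>

lemma has_sum_imp_nnsum:
  fixes f :: "'a \<Rightarrow> real"
  assumes "(f has_sum s) UNIV" and "\<And>i. 0 \<le> f i"
  shows "nnsum (\<lambda>i. ennreal (f i)) = ennreal s"
proof -
  have "Infinite_Sum.abs_summable_on f UNIV"
    using has_sum_imp_summable[OF assms(1)] assms(2) by simp
  then have abs: "Infinite_Set_Sum.abs_summable_on f UNIV"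
    by (simp only: abs_summable_equivalent)
  show ?thesis
    using nn_integral_conv_infsetsum[OF abs] assms(2) infsetsum_infsum[OF abs] infsumI[OF assms(1)]
    by simp
qed

lemma nnsum_finite_imp_summable:
  fixes f :: "'a \<Rightarrow> real"
  assumes "nnsum (\<lambda>i. ennreal \<bar>f i\<bar>) < \<infinity>"
  shows "f summable_on UNIV"
proof -
  have "integrable (count_space UNIV) f"
    using assms by (intro integrableI_bounded) auto
  then have "Infinite_Set_Sum.abs_summable_on f UNIV"
    by (simp add: abs_summable_on_def)
  then show ?thesis
    by (simp only: abs_summable_equivalent summable_on_iff_abs_summable_on_real)
qed

lemma nnsum_imp_has_sum:
  fixes f :: "'a \<Rightarrow> real"
  assumes "nnsum (\<lambda>i. ennreal (f i)) = ennreal s" and "\<And>i. 0 \<le> f i" and "0 \<le> s"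
  shows "(f has_sum s) UNIV"
proof -
  have "f summable_on UNIV"
    using assms by (intro nnsum_finite_imp_summable) simp
  then have h: "(f has_sum infsum f UNIV) UNIV"
    by (rule has_sum_infsum)
  from has_sum_imp_nnsum[OF h assms(2)] assms infsum_nonneg[of UNIV f]
  have "infsum f UNIV = s"
    by (simp add: ennreal_inj)
  with h show ?thesis
    by simp
qed

text \<open>Bridge from the norms and the drift hypothesis, which are sums in \<open>ereal\<close>,
  to \<open>nnsum\<close>. The \<open>ereal\<close> sum is the supremum of the finite partial sums;
  without summability these are unbounded and both sides are \<open>\<infinity>\<close>.\<close>

lemma infsum_ereal_eq_nnsum:
  fixes f :: "'a \<Rightarrow> real"
  assumes nn: "\<And>i. 0 \<le> f i"
  shows "(\<Sum>\<^sub>\<infinity>i. ereal (f i)) = enn2ereal (nnsum (\<lambda>i. ennreal (f i)))"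
proof (cases "f summable_on UNIV")
  case True
  then have h: "(f has_sum infsum f UNIV) UNIV"
    by (rule has_sum_infsum)
  have "(\<Sum>\<^sub>\<infinity>i. ereal (f i)) = (SUP F\<in>{F. finite F \<and> F \<subseteq> UNIV}. \<Sum>i\<in>F. ereal (f i))"
    using nn by (intro nonneg_infsum_complete) simp
  also have "\<dots> = ereal (infsum f UNIV)"
    using infsum_nonneg_is_SUPREMUM_ereal[OF True] nn by simp
  also have "\<dots> = enn2ereal (nnsum (\<lambda>i. ennreal (f i)))"
    using has_sum_imp_nnsum[OF h nn] infsum_nonneg[of UNIV f] nn by simp
  finally show ?thesis .
next
  case False
  have "nnsum (\<lambda>i. ennreal (f i)) = \<infinity>"
    using False nnsum_finite_imp_summable[of f] nn by (intro ccontr[of "_ = \<infinity>"]) (simp add: top.not_eq_extremum)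
  moreover have "(\<Sum>\<^sub>\<infinity>i. ereal (f i)) = \<infinity>"
  proof (rule ccontr)
    assume "(\<Sum>\<^sub>\<infinity>i. ereal (f i)) \<noteq> \<infinity>"
    then obtain B where "(\<Sum>\<^sub>\<infinity>i. ereal (f i)) \<le> ereal B"
      by (cases "(\<Sum>\<^sub>\<infinity>i. ereal (f i))") auto
    moreover have "(\<Sum>\<^sub>\<infinity>i. ereal (f i)) = (SUP F\<in>{F. finite F \<and> F \<subseteq> UNIV}. \<Sum>i\<in>F. ereal (f i))"
      using nn by (intro nonneg_infsum_complete) simp
    ultimately have "sum f F \<le> B" if "finite F" for F
      using that by (auto simp: SUP_le_iff)
    then have "f summable_on UNIV"
      using nn by (intro nonneg_bdd_above_summable_on) (auto intro!: bdd_aboveI2)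
    with False show False ..
  qed
  ultimately show ?thesis
    by simp
qed

lemma has_sum_abs_le_nnsum:
  fixes f :: "'a \<Rightarrow> real"
  assumes "(f has_sum s) UNIV"
  shows "ennreal \<bar>s\<bar> \<le> nnsum (\<lambda>i. ennreal \<bar>f i\<bar>)"
proof -
  have "(\<lambda>i. \<bar>f i\<bar>) summable_on UNIV"
    using has_sum_imp_summable[OF assms] summable_on_iff_abs_summable_on_real[of f UNIV] by simp
  then have h: "((\<lambda>i. \<bar>f i\<bar>) has_sum infsum (\<lambda>i. \<bar>f i\<bar>) UNIV) UNIV"
    by (rule has_sum_infsum)
  have "\<bar>s\<bar> \<le> infsum (\<lambda>i. \<bar>f i\<bar>) UNIV"
    using norm_infsum_bound[of f UNIV] has_sum_imp_summable[OF h] infsumI[OF assms] by simp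
  then show ?thesis
    using has_sum_imp_nnsum[OF h] by (simp add: ennreal_leI)
qed

lemma has_sum_diff:
  fixes f g :: "'a \<Rightarrow> real"
  assumes "(f has_sum s) A" "(g has_sum t) A"
  shows "((\<lambda>x. f x - g x) has_sum s - t) A"
  using has_sum_add[OF assms(1), of "\<lambda>x. - g x" "- t"] assms(2) by (simp add: has_sum_uminus)

text \<open>Duality between a kernel acting on measures and on functions (Tonelli). With
  \<open>g = V\<close> it turns invariance equations into statements about the rows, to which the
  drift condition applies.\<close>

lemma nnsum_kernel:
  fixes k :: "'a::countable \<Rightarrow> 'a \<Rightarrow> ennreal"
  shows "nnsum (\<lambda>j. nnsum (\<lambda>i. f i * k i j) * g j) = nnsum (\<lambda>i. f i * nnsum (\<lambda>j. k i j * g j))"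
proof -
  have "nnsum (\<lambda>j. nnsum (\<lambda>i. f i * k i j) * g j) = nnsum (\<lambda>j. nnsum (\<lambda>i. f i * (k i j * g j)))"
    by (simp add: nnsum_multc[symmetric] mult.assoc)
  also have "\<dots> = nnsum (\<lambda>i. nnsum (\<lambda>j. f i * (k i j * g j)))"
    by (rule nnsum_swap)
  finally show ?thesis
    by (simp add: nnsum_cmult)
qed

section \<open>Invariant measures under a drift condition\<close>

lemma stochastic_nonneg: "stochastic P \<Longrightarrow> 0 \<le> P i j"
  by (simp add: stochastic_def)

lemma stochastic_nnsum: "stochastic P \<Longrightarrow> nnsum (\<lambda>j. ennreal (P i j)) = 1"
  using has_sum_imp_nnsum[of "P i" 1] by (auto simp: stochastic_def)

lemma invariant_nnsum:
  assumes "stochastic P" "invariant_prob P \<mu>"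
  shows "nnsum (\<lambda>i. ennreal (\<mu> i)) = 1"
    and "nnsum (\<lambda>i. ennreal (\<mu> i) * ennreal (P i j)) = ennreal (\<mu> j)"
proof -
  show "nnsum (\<lambda>i. ennreal (\<mu> i)) = 1"
    using has_sum_imp_nnsum[of \<mu> 1] assms by (auto simp: invariant_prob_def)
  have "nnsum (\<lambda>i. ennreal (\<mu> i * P i j)) = ennreal (\<mu> j)"
    using has_sum_imp_nnsum[of "\<lambda>i. \<mu> i * P i j"] assms
    by (auto simp: invariant_prob_def stochastic_def)
  then show "nnsum (\<lambda>i. ennreal (\<mu> i) * ennreal (P i j)) = ennreal (\<mu> j)"
    using assms by (simp add: ennreal_mult invariant_prob_def stochastic_def)
qed

text \<open>Mass propagates along paths: \<open>d k\<close> is a sum of nonnegative terms, one of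
  them \<open>d i * P i k\<close>, so positivity passes from \<open>i\<close> to every successor
  \<open>k\<close>. No normalization is imposed on \<open>d\<close>, because uniqueness is proved by
  applying this to a difference of multiples of invariant probabilities.\<close>

lemma invariant_pos:
  assumes "stochastic P" "irreducible_matrix P"
    and nn: "\<And>i. 0 \<le> d i" and inv: "\<And>j. ((\<lambda>i. d i * P i j) has_sum d j) UNIV"
    and "0 < d i"
  shows "0 < d j"
proof -
  have P0: "0 \<le> P i j" for i j
    using assms(1) by (rule stochastic_nonneg)
  have M0: "0 \<le> matpow P n i j" for n i j
    by (induction n arbitrary: i) (auto intro!: infsum_nonneg simp: P0)
  have "0 < matpow P n i j \<Longrightarrow> 0 < d i \<Longrightarrow> 0 < d j" for n
  proof (induction n arbitrary: i)
    case 0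
    then show ?case by (simp split: if_splits)
  next
    case (Suc n)
    have "\<exists>k. P i k * matpow P n k j \<noteq> 0"
      using Suc.prems(1) by (metis (mono_tags, lifting) infsum_0 less_irrefl matpow.simps(2))
    then obtain k where k: "0 < P i k" "0 < matpow P n k j"
      using P0[of i] M0[of n] by (metis less_eq_real_def mult_zero_left mult_zero_right)
    have "d i * P i k \<le> d k"
      using has_sum_mono_neutral[OF has_sum_finite[of "{i}" "\<lambda>i. d i * P i k"] inv[of k]] nn P0
      by simp
    with k(1) Suc.prems(2) have "0 < d k"
      using mult_pos_pos by (metis order_less_le_trans)
    with Suc.IH k show ?case by blast
  qed
  with assms(2,5) show ?thesis
    unfolding irreducible_matrix_def by blast
qed

lemma invariant_prob_pos:
  assumes "stochastic P" "irreducible_matrix P" "invariant_prob P \<mu>"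
  shows "0 < \<mu> i"
proof -
  have nn: "\<And>i. 0 \<le> \<mu> i" and s: "(\<mu> has_sum 1) UNIV"
    and inv: "\<And>j. ((\<lambda>i. \<mu> i * P i j) has_sum \<mu> j) UNIV"
    using assms by (auto simp: invariant_prob_def)
  have "\<exists>k. \<mu> k \<noteq> 0"
    using infsumI[OF s] infsum_0[of UNIV \<mu>] by force
  then obtain k where "0 < \<mu> k"
    using nn by (metis less_eq_real_def)
  from invariant_pos[OF assms(1,2) nn inv this] show ?thesis .
qed

text \<open>\<open>excursion P i0 n j\<close> is the expected number of visits to \<open>j\<close> at times \<open>1, \<dots>, n\<close>, up to
  and including the first return to \<open>i0\<close>, of the chain started in \<open>i0\<close>.\<close>

primrec excursion :: "('a::countable \<Rightarrow> 'a \<Rightarrow> real) \<Rightarrow> 'a \<Rightarrow> nat \<Rightarrow> 'a \<Rightarrow> ennreal" where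
  "excursion P i0 0 = (\<lambda>j. 0)"
| "excursion P i0 (Suc n) =
     (\<lambda>j. ennreal (P i0 j) + nnsum (\<lambda>i. ((excursion P i0 n)(i0 := 0)) i * ennreal (P i j)))"

text \<open>Visits during a whole excursion. Time 0 is not counted, so the value at
  \<open>i0\<close> is the probability of ever returning to \<open>i0\<close>.\<close>

definition excursion_measure :: "('a::countable \<Rightarrow> 'a \<Rightarrow> real) \<Rightarrow> 'a \<Rightarrow> 'a \<Rightarrow> ennreal" where
  "excursion_measure P i0 j = (SUP n. excursion P i0 n j)"

lemma incseq_excursion: "incseq (\<lambda>n. excursion P i0 n j)"
proof (rule incseq_SucI)
  fix n show "excursion P i0 n j \<le> excursion P i0 (Suc n) j"
  proof (induction n arbitrary: j)
    case (Suc n)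
    have "((excursion P i0 n)(i0 := 0)) i \<le> ((excursion P i0 (Suc n))(i0 := 0)) i" for i
      using Suc.IH by (simp del: excursion.simps)
    then show ?case
      unfolding excursion.simps(2)[of P i0 "Suc n"] excursion.simps(2)[of P i0 n, THEN fun_cong]
      by (intro add_left_mono nnsum_mono mult_right_mono) auto
  qed simp
qed

text \<open>Monotone convergence carries the recursion for \<open>excursion\<close> over to its
  supremum. Deleting the entry at \<open>i0\<close> expresses that the excursion stops
  there.\<close>

lemma excursion_measure_eq:
  "excursion_measure P i0 j = ennreal (P i0 j) +
     nnsum (\<lambda>i. ((excursion_measure P i0)(i0 := 0)) i * ennreal (P i j))"
proof -
  let ?f = "\<lambda>n i. ((excursion P i0 n)(i0 := 0)) i * ennreal (P i j)"
  have f: "incseq ?f"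
    using incseq_excursion[of P i0] by (auto simp: incseq_def le_fun_def intro!: mult_right_mono)
  have "excursion_measure P i0 j = (SUP n. excursion P i0 (Suc n) j)"
    unfolding excursion_measure_def
    by (rule SUP_eq) (use incseq_SucD[OF incseq_excursion[of P i0 j]] in \<open>blast+\<close>)
  also have "\<dots> = ennreal (P i0 j) + (SUP n. nnsum (?f n))"
    by (simp add: ennreal_SUP_add_right)
  also have "(SUP n. nnsum (?f n)) = nnsum (\<lambda>i. SUP n. ?f n i)"
    using f by (intro nn_integral_monotone_convergence_SUP[symmetric]) auto
  also have "\<dots> = nnsum (\<lambda>i. ((excursion_measure P i0)(i0 := 0)) i * ennreal (P i j))"
    by (intro nn_integral_cong) (auto simp: excursion_measure_def SUP_mult_right_ennreal)
  finally show ?thesis .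
qed

text \<open>A locale because the condition is used for two matrices: \<open>P\<close> with
  \<open>lam\<close>, and the perturbed matrix with a larger contraction constant. The number
  \<open>eps\<close> stands for the positive infimum of \<open>V\<close>.\<close>

locale drift =
  fixes P :: "'a::countable \<Rightarrow> 'a \<Rightarrow> real" and V :: "'a \<Rightarrow> real" and i0 :: 'a and lam b eps :: real
  assumes stoch: "stochastic P" and irred: "irreducible_matrix P"
    and eps: "0 < eps" and V_ge: "eps \<le> V i"
    and lam: "0 < lam" "lam < 1" and b: "0 < b"
    and drift: "nnsum (\<lambda>j. ennreal (P i j) * ennreal (V j)) \<le> ennreal (lam * V i + b * indicator {i0} i)"
begin

lemma V_pos: "0 < V i"
  using eps V_ge[of i] by linarith

lemma drift_off: "i \<noteq> i0 \<Longrightarrow> nnsum (\<lambda>j. ennreal (P i j) * ennreal (V j)) \<le> ennreal lam * ennreal (V i)"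
  using drift[of i] lam V_pos[of i] by (simp add: ennreal_mult)

section \<open>The excursion measure under drift: V-finiteness and invariance\<close>

lemma finite_mass:
  assumes "nnsum (\<lambda>i. f i * ennreal (V i)) < \<infinity>"
  shows "nnsum f < \<infinity>"
proof -
  have "ennreal 1 \<le> ennreal (1 / eps) * ennreal (V i)" for i
    using eps V_ge[of i] V_pos[of i] by (subst ennreal_mult[symmetric]) (auto intro!: ennreal_leI)
  then have "f i * 1 \<le> f i * (ennreal (1 / eps) * ennreal (V i))" for i
    by (intro mult_left_mono) auto
  then have "nnsum f \<le> nnsum (\<lambda>i. ennreal (1 / eps) * (f i * ennreal (V i)))"
    by (intro nnsum_mono) (simp add: ac_simps)
  also have "\<dots> < \<infinity>"
    using assms by (simp add: nnsum_cmult ennreal_mult_less_top)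
  finally show ?thesis .
qed

text \<open>Row \<open>i0\<close> enters only through the first step of the excursion, since the
  recursion deletes the mass at \<open>i0\<close>; every later step contracts the V-weighted mass by
  \<open>lam\<close>.\<close>

lemma excursion_V:
  "nnsum (\<lambda>j. excursion P i0 n j * ennreal (V j)) \<le> ennreal ((lam * V i0 + b) / (1 - lam))"
proof (induction n)
  case (Suc n)
  \<comment> \<open>The fixed point of \<open>K = lam * V i0 + b + lam * K\<close>, so that the
    bound reproduces itself in the induction.\<close>
  define K where "K = (lam * V i0 + b) / (1 - lam)"
  have K: "lam * V i0 + b + lam * K = K" "0 \<le> K"
    using lam b V_pos[of i0] by (auto simp: K_def field_simps)
  let ?f = "(excursion P i0 n)(i0 := 0)"
  have "nnsum (\<lambda>j. excursion P i0 (Suc n) j * ennreal (V j)) =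
      nnsum (\<lambda>j. ennreal (P i0 j) * ennreal (V j)) +
      nnsum (\<lambda>j. nnsum (\<lambda>i. ?f i * ennreal (P i j)) * ennreal (V j))"
    by (simp add: nnsum_add distrib_right)
  also have "\<dots> = nnsum (\<lambda>j. ennreal (P i0 j) * ennreal (V j)) +
      nnsum (\<lambda>i. ?f i * nnsum (\<lambda>j. ennreal (P i j) * ennreal (V j)))"
    by (simp only: nnsum_kernel)
  also have "\<dots> \<le> ennreal (lam * V i0 + b) +
      nnsum (\<lambda>i. ennreal lam * (excursion P i0 n i * ennreal (V i)))"
  proof (intro add_mono nnsum_mono)
    show "nnsum (\<lambda>j. ennreal (P i0 j) * ennreal (V j)) \<le> ennreal (lam * V i0 + b)"
      using drift[of i0] by simp
    fix i
    show "?f i * nnsum (\<lambda>j. ennreal (P i j) * ennreal (V j)) \<le>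
        ennreal lam * (excursion P i0 n i * ennreal (V i))"
      using mult_left_mono[OF drift_off[of i], of "excursion P i0 n i"]
      by (auto simp: ac_simps)
  qed
  also have "\<dots> \<le> ennreal (lam * V i0 + b) + ennreal lam * ennreal K"
    using Suc.IH by (auto simp: nnsum_cmult K_def intro!: add_left_mono mult_left_mono)
  also have "\<dots> = ennreal K"
    using K lam b V_pos[of i0] by (simp add: ennreal_mult[symmetric] ennreal_plus[symmetric] del: ennreal_plus)
  finally show ?case by (simp only: K_def)
qed simp

lemma excursion_measure_V: "nnsum (\<lambda>j. excursion_measure P i0 j * ennreal (V j)) < \<infinity>"
proof -
  have "nnsum (\<lambda>j. excursion_measure P i0 j * ennreal (V j)) =
      nnsum (\<lambda>j. SUP n. excursion P i0 n j * ennreal (V j))"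
    by (simp add: excursion_measure_def SUP_mult_right_ennreal)
  also have "\<dots> = (SUP n. nnsum (\<lambda>j. excursion P i0 n j * ennreal (V j)))"
    using incseq_excursion[of P i0]
    by (intro nn_integral_monotone_convergence_SUP)
       (auto simp: incseq_def le_fun_def intro!: mult_right_mono)
  also have "\<dots> \<le> ennreal ((lam * V i0 + b) / (1 - lam))"
    by (intro SUP_least excursion_V)
  finally show ?thesis
    by (simp add: order_le_less_trans)
qed

lemma excursion_measure_mass: "nnsum (excursion_measure P i0) < \<infinity>"
  by (rule finite_mass[OF excursion_measure_V])

text \<open>Sum \<open>excursion_measure_eq\<close> over all states and compare the total masses, which are finite.\<close>

lemma excursion_measure_base: "excursion_measure P i0 i0 = 1"
proof -
  let ?m = "excursion_measure P i0"
  have row: "nnsum (\<lambda>j. ennreal (P i j)) = 1" for i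
    using stoch by (rule stochastic_nnsum)
  have "nnsum (\<lambda>j. nnsum (\<lambda>i. (?m(i0 := 0)) i * ennreal (P i j))) = nnsum (?m(i0 := 0))"
    using nnsum_kernel[of "?m(i0 := 0)" "\<lambda>i j. ennreal (P i j)" "\<lambda>_. 1"]
    by (simp only: row mult_1_right)
  then have eq: "nnsum ?m = 1 + nnsum (?m(i0 := 0))"
    by (subst excursion_measure_eq[abs_def]) (simp only: nnsum_add row)
  have "nnsum ?m = ?m i0 + nnsum (?m(i0 := 0))"
    using nnsum_split[of ?m i0] by (simp add: fun_upd_def)
  moreover from eq have "nnsum (?m(i0 := 0)) < \<infinity>"
    using excursion_measure_mass by (auto simp: top.not_eq_extremum)
  ultimately show ?thesis
    using eq by (metis add.commute ennreal_add_left_cancel infinity_ennreal_def less_irrefl)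
qed

text \<open>Since the mass at \<open>i0\<close> is 1, the isolated term \<open>P i0 j\<close> in
  \<open>excursion_measure_eq\<close> is exactly the missing \<open>i0\<close> term of the
  invariance sum.\<close>

lemma excursion_measure_invariant:
  "nnsum (\<lambda>i. excursion_measure P i0 i * ennreal (P i j)) = excursion_measure P i0 j"
proof -
  let ?m = "excursion_measure P i0"
  have "nnsum (\<lambda>i. ?m i * ennreal (P i j)) =
      ?m i0 * ennreal (P i0 j) + nnsum (\<lambda>i. if i = i0 then 0 else ?m i * ennreal (P i j))"
    by (rule nnsum_split)
  also have "(\<lambda>i. if i = i0 then 0 else ?m i * ennreal (P i j)) = (\<lambda>i. (?m(i0 := 0)) i * ennreal (P i j))"
    by auto
  finally show ?thesis
    using excursion_measure_eq[of P i0 j] excursion_measure_base by simp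
qed

text \<open>Minimality of the excursion measure: iterating the invariance equation of
  \<open>\<mu>\<close>, with the \<open>i0\<close> term set aside at each step, generates
  \<open>\<mu> i0\<close> times the excursion sums.\<close>

lemma excursion_le_invariant:
  assumes "invariant_prob P \<mu>"
  shows "ennreal (\<mu> i0) * excursion P i0 n j \<le> ennreal (\<mu> j)"
proof (induction n arbitrary: j)
  case (Suc n)
  let ?f = "(excursion P i0 n)(i0 := 0)" and ?\<mu> = "\<lambda>i. if i = i0 then 0 else ennreal (\<mu> i) * ennreal (P i j)"
  have "ennreal (\<mu> i0) * excursion P i0 (Suc n) j = ennreal (\<mu> i0) * ennreal (P i0 j) +
      nnsum (\<lambda>i. ennreal (\<mu> i0) * ?f i * ennreal (P i j))"
    by (simp add: distrib_left nnsum_cmult mult.assoc)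
  also have "\<dots> \<le> ennreal (\<mu> i0) * ennreal (P i0 j) + nnsum ?\<mu>"
    using Suc.IH by (intro add_left_mono nnsum_mono) (auto intro!: mult_right_mono)
  also have "\<dots> = ennreal (\<mu> j)"
    using nnsum_split[of "\<lambda>i. ennreal (\<mu> i) * ennreal (P i j)" i0] invariant_nnsum(2)[OF stoch assms]
    by simp
  finally show ?case .
qed simp

text \<open>The witness is the normalized excursion measure. The last conjunct is its minimality
  with denominators cleared, kept for the uniqueness proof.\<close>

lemma ex_invariant:
  "\<exists>\<nu>. invariant_prob P \<nu> \<and> nnsum (\<lambda>i. ennreal (\<nu> i) * ennreal (V i)) < \<infinity> \<and>
     (\<forall>\<mu> j. invariant_prob P \<mu> \<longrightarrow> \<mu> i0 * \<nu> j \<le> \<nu> i0 * \<mu> j)"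
proof -
  let ?m = "excursion_measure P i0"
  define Z where "Z = enn2real (nnsum ?m)"
  define \<nu> where "\<nu> j = enn2real (?m j) / Z" for j
  have Z: "nnsum ?m = ennreal Z"
    using excursion_measure_mass by (simp add: Z_def)
  have "1 \<le> nnsum ?m"
    using nnsum_member_le[of ?m i0] excursion_measure_base by simp
  then have "1 \<le> Z"
    by (simp add: Z)
  have m_fin: "?m j < \<infinity>" for j
    using nnsum_member_le[of ?m j] excursion_measure_mass by (rule order_le_less_trans)
  then have mr: "ennreal (enn2real (?m j)) = ?m j" for j
    by simp
  have \<nu>0: "0 \<le> \<nu> j" for j
    using \<open>1 \<le> Z\<close> by (simp add: \<nu>_def)
  have \<nu>: "ennreal (\<nu> j) = ennreal (1 / Z) * ?m j" for j
  proof -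
    have "ennreal (\<nu> j) = ennreal (1 / Z) * ennreal (enn2real (?m j))"
      unfolding \<nu>_def using \<open>1 \<le> Z\<close> by (subst ennreal_mult[symmetric]) auto
    then show ?thesis
      by (simp only: mr)
  qed
  have "invariant_prob P \<nu>"
    unfolding invariant_prob_def
  proof (intro conjI allI nnsum_imp_has_sum)
    show "nnsum (\<lambda>i. ennreal (\<nu> i)) = ennreal 1"
      using \<open>1 \<le> Z\<close> by (simp add: \<nu> nnsum_cmult Z ennreal_mult[symmetric])
    fix j
    have "nnsum (\<lambda>i. ennreal (\<nu> i * P i j)) = nnsum (\<lambda>i. ennreal (1 / Z) * (?m i * ennreal (P i j)))"
      using \<nu>0 stochastic_nonneg[OF stoch] by (simp add: ennreal_mult \<nu> mult.assoc)
    then show "nnsum (\<lambda>i. ennreal (\<nu> i * P i j)) = ennreal (\<nu> j)"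
      by (simp add: nnsum_cmult excursion_measure_invariant \<nu>)
  qed (use \<nu>0 stochastic_nonneg[OF stoch] in auto)
  moreover have "nnsum (\<lambda>i. ennreal (\<nu> i) * ennreal (V i)) < \<infinity>"
    using excursion_measure_V by (simp add: \<nu> mult.assoc nnsum_cmult ennreal_mult_less_top)
  moreover have "\<mu> i0 * \<nu> j \<le> \<nu> i0 * \<mu> j" if "invariant_prob P \<mu>" for \<mu> j
  proof -
    have \<mu>0: "0 \<le> \<mu> i" for i
      using that by (simp add: invariant_prob_def)
    have "ennreal (\<mu> i0) * ?m j \<le> ennreal (\<mu> j)"
      unfolding excursion_measure_def SUP_mult_left_ennreal
      by (intro SUP_least excursion_le_invariant[OF that])
    then have "ennreal (\<mu> i0 * enn2real (?m j)) \<le> ennreal (\<mu> j)"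
      using \<mu>0 mr[of j] by (simp add: ennreal_mult)
    then have "\<mu> i0 * enn2real (?m j) \<le> \<mu> j"
      using \<mu>0 by simp
    then show ?thesis
      \<comment> \<open>The excursion measure is 1 at \<open>i0\<close>, hence
        \<open>\<nu> i0 = 1 / Z\<close>.\<close>
      using \<open>1 \<le> Z\<close> by (simp add: \<nu>_def excursion_measure_base divide_right_mono)
  qed
  ultimately show ?thesis by blast
qed

text \<open>For another invariant probability \<open>\<mu>\<close>, the function
  \<open>d = \<nu> i0 * \<mu> - \<mu> i0 * \<nu>\<close> is invariant, nonnegative by minimality,
  and zero at \<open>i0\<close>. Irreducibility forces \<open>d = 0\<close>; comparing total masses
  then gives \<open>\<nu> i0 = \<mu> i0\<close>.\<close>

lemma unique_invariant:
  "\<exists>\<nu>. unique_invariant_prob P \<nu> \<and> nnsum (\<lambda>i. ennreal (\<nu> i) * ennreal (V i)) < \<infinity>"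
proof -
  obtain \<nu> where \<nu>: "invariant_prob P \<nu>" "nnsum (\<lambda>i. ennreal (\<nu> i) * ennreal (V i)) < \<infinity>"
    and le: "\<And>\<mu> j. invariant_prob P \<mu> \<Longrightarrow> \<mu> i0 * \<nu> j \<le> \<nu> i0 * \<mu> j"
    using ex_invariant by blast
  have "\<mu> = \<nu>" if "invariant_prob P \<mu>" for \<mu>
  proof -
    define d where "d j = \<nu> i0 * \<mu> j - \<mu> i0 * \<nu> j" for j
    have d0: "0 \<le> d j" for j
      using le[OF that, of j] by (simp add: d_def)
    have "((\<lambda>i. \<nu> i0 * (\<mu> i * P i j) - \<mu> i0 * (\<nu> i * P i j)) has_sum d j) UNIV" for j
      unfolding d_def using that \<nu>(1)
      by (intro has_sum_diff has_sum_cmult_right) (auto simp: invariant_prob_def)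
    then have inv: "((\<lambda>i. d i * P i j) has_sum d j) UNIV" for j
      by (simp add: d_def left_diff_distrib mult.assoc)
    have d: "d j = 0" for j
    proof (rule ccontr)
      assume "d j \<noteq> 0"
      then have "0 < d j" using d0[of j] by linarith
      from invariant_pos[OF stoch irred d0 inv this, of i0] show False
        by (simp add: d_def)
    qed
    have "(d has_sum \<nu> i0 * 1 - \<mu> i0 * 1) UNIV"
      unfolding d_def using that \<nu>(1)
      by (intro has_sum_diff has_sum_cmult_right) (auto simp: invariant_prob_def)
    then have "\<nu> i0 = \<mu> i0"
      using d infsumI[of d] infsum_0[of UNIV d] by simp
    with d have "\<nu> i0 * (\<mu> j - \<nu> j) = 0" for j
      by (simp add: d_def right_diff_distrib)
    with invariant_prob_pos[OF stoch irred \<nu>(1), of i0] show ?thesis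
      by (intro ext) (metis eq_iff_diff_eq_0 less_irrefl mult_eq_0_iff)
  qed
  with \<nu> show ?thesis
    unfolding unique_invariant_prob_def by blast
qed

section \<open>V-norm of an invariant probability\<close>

lemma invariant_V_finite:
  assumes "invariant_prob P \<mu>"
  shows "nnsum (\<lambda>i. ennreal (\<mu> i) * ennreal (V i)) < \<infinity>"
  using unique_invariant assms by (auto simp: unique_invariant_prob_def)

text \<open>Integrating the drift inequality against \<open>\<mu>\<close>, with the indicator
  bounded by 1, gives \<open>x \<le> lam * x + b\<close> for the V-norm \<open>x\<close>. Solving
  for \<open>x\<close> is legitimate because \<open>x\<close> is already known to be finite.\<close>

lemma invariant_V_le:
  assumes "invariant_prob P \<mu>"
  shows "nnsum (\<lambda>i. ennreal (\<mu> i) * ennreal (V i)) \<le> ennreal (b / (1 - lam))"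
proof -
  let ?X = "nnsum (\<lambda>i. ennreal (\<mu> i) * ennreal (V i))"
  define x where "x = enn2real ?X"
  have x: "?X = ennreal x" "0 \<le> x"
    using invariant_V_finite[OF assms] by (simp_all add: x_def)
  have "?X = nnsum (\<lambda>j. nnsum (\<lambda>i. ennreal (\<mu> i) * ennreal (P i j)) * ennreal (V j))"
    by (simp only: invariant_nnsum[OF stoch assms])
  also have "\<dots> = nnsum (\<lambda>i. ennreal (\<mu> i) * nnsum (\<lambda>j. ennreal (P i j) * ennreal (V j)))"
    by (rule nnsum_kernel)
  also have "\<dots> \<le> nnsum (\<lambda>i. ennreal lam * (ennreal (\<mu> i) * ennreal (V i)) + ennreal b * ennreal (\<mu> i))"
  proof (rule nnsum_mono)
    fix i
    have "ennreal (lam * V i + b * indicator {i0} i) \<le> ennreal lam * ennreal (V i) + ennreal b"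
      using lam b V_pos[of i] by (auto simp: indicator_def ennreal_mult[symmetric] ennreal_plus[symmetric]
          simp del: ennreal_plus intro!: ennreal_leI)
    with drift[of i] have "nnsum (\<lambda>j. ennreal (P i j) * ennreal (V j)) \<le> ennreal lam * ennreal (V i) + ennreal b"
      by (rule order_trans)
    from mult_left_mono[OF this, of "ennreal (\<mu> i)"]
    show "ennreal (\<mu> i) * nnsum (\<lambda>j. ennreal (P i j) * ennreal (V j)) \<le>
        ennreal lam * (ennreal (\<mu> i) * ennreal (V i)) + ennreal b * ennreal (\<mu> i)"
      by (simp add: distrib_left ac_simps)
  qed
  also have "\<dots> = ennreal lam * ?X + ennreal b"
    by (simp add: nnsum_add nnsum_cmult invariant_nnsum(1)[OF stoch assms])
  finally have "x \<le> lam * x + b"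
    using x lam b by (simp add: ennreal_mult[symmetric] ennreal_plus[symmetric] del: ennreal_plus)
  then show ?thesis
    using lam b x by (auto simp: field_simps intro!: ennreal_leI)
qed

end

section \<open>Return times\<close>

text \<open>\<open>avoid P j n i\<close> is the probability that the chain started in \<open>i\<close> does not visit \<open>j\<close> at the
  times \<open>1, \<dots>, n\<close>.\<close>

primrec avoid :: "('a::countable \<Rightarrow> 'a \<Rightarrow> real) \<Rightarrow> 'a \<Rightarrow> nat \<Rightarrow> 'a \<Rightarrow> ennreal" where
  "avoid P j 0 = (\<lambda>i. 1)"
| "avoid P j (Suc n) = (\<lambda>i. nnsum (\<lambda>k. ennreal (P i k) * ((avoid P j n)(j := 0)) k))"

text \<open>Kac's formula, as a telescoping sum: by invariance, \<open>\<mu> j * avoid P j n j\<close> is the difference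
  between the stationary probabilities of avoiding \<open>j\<close> for \<open>n\<close> and for \<open>n + 1\<close> steps.\<close>

lemma invariant_avoid:
  assumes "stochastic P" "invariant_prob P \<mu>"
  shows "ennreal (\<mu> j) * (\<Sum>n<N. avoid P j n j) + nnsum (\<lambda>i. ennreal (\<mu> i) * avoid P j N i) = 1"
proof (induction N)
  case 0
  then show ?case
    using invariant_nnsum(1)[OF assms] by simp
next
  case (Suc N)
  let ?g = "(avoid P j N)(j := 0)"
  have "nnsum (\<lambda>i. ennreal (\<mu> i) * avoid P j (Suc N) i) =
      nnsum (\<lambda>k. nnsum (\<lambda>i. ennreal (\<mu> i) * ennreal (P i k)) * ?g k)"
    unfolding avoid.simps nnsum_kernel ..
  also have "\<dots> = nnsum (\<lambda>k. ennreal (\<mu> k) * ?g k)"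
    by (simp only: invariant_nnsum(2)[OF assms])
  also have "(\<lambda>k. ennreal (\<mu> k) * ?g k) = (\<lambda>k. if k = j then 0 else ennreal (\<mu> k) * avoid P j N k)"
    by auto
  finally have "ennreal (\<mu> j) * avoid P j N j + nnsum (\<lambda>i. ennreal (\<mu> i) * avoid P j (Suc N) i) =
      nnsum (\<lambda>i. ennreal (\<mu> i) * avoid P j N i)"
    using nnsum_split[of "\<lambda>i. ennreal (\<mu> i) * avoid P j N i" j] by simp
  with Suc.IH show ?case
    by (simp add: distrib_left add.assoc del: avoid.simps)
qed

section \<open>Avoidance probabilities under the path measure\<close>

lemma space_chain_law: "stochastic P \<Longrightarrow> space (chain_law P i) = UNIV"
  using sets_eq_imp_space_eq[OF sets_chain_law[of P i]] by (simp add: space_PiM)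

lemma sets_chain_lawI:
  assumes "stochastic P" "Measurable.pred (PiM UNIV (\<lambda>_. count_space UNIV)) Q"
  shows "{\<omega>. Q \<omega>} \<in> sets (chain_law P i)"
  using assms(2) unfolding sets_chain_law[OF assms(1)] pred_def by (simp add: space_PiM)

text \<open>Fixing an initial segment \<open>x 0, \<dots>, x m\<close> of the path makes the induction go through.\<close>

lemma emeasure_chain_law_prefix_avoid:
  fixes P :: "'a::countable \<Rightarrow> 'a \<Rightarrow> real"
  assumes "stochastic P"
  shows "emeasure (chain_law P i) {\<omega>. (\<forall>k\<le>m. \<omega> k = x k) \<and> (\<forall>k\<in>{m<..m + n}. \<omega> k \<noteq> j)} =
    (if x 0 = i then ennreal (\<Prod>k<m. P (x k) (x (Suc k))) else 0) * avoid P j n (x m)"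
proof (induction n arbitrary: m x)
  case 0
  then show ?case
    using emeasure_chain_law[OF assms, of i m x] by simp
next
  case (Suc n)
  \<comment> \<open>Splits the event by the value \<open>a\<close> at time \<open>m + 1\<close>. The
    empty set for \<open>a = j\<close> matches the deleted entry in
    \<open>(avoid P j n)(j := 0)\<close>.\<close>
  define X where "X a = (if a = j then {} else
    {\<omega>. (\<forall>k\<le>Suc m. \<omega> k = (x(Suc m := a)) k) \<and> (\<forall>k\<in>{Suc m<..Suc m + n}. \<omega> k \<noteq> j)})" for a
  let ?c = "if x 0 = i then ennreal (\<Prod>k<m. P (x k) (x (Suc k))) else 0"
  have "{\<omega>. (\<forall>k\<le>m. \<omega> k = x k) \<and> (\<forall>k\<in>{m<..m + Suc n}. \<omega> k \<noteq> j)} = (\<Union>a. X a)"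
  proof (intro set_eqI iffI)
    fix \<omega> assume "\<omega> \<in> {\<omega>. (\<forall>k\<le>m. \<omega> k = x k) \<and> (\<forall>k\<in>{m<..m + Suc n}. \<omega> k \<noteq> j)}"
    then have *: "\<And>k. k \<le> m \<Longrightarrow> \<omega> k = x k" "\<And>k. k \<in> {m<..m + Suc n} \<Longrightarrow> \<omega> k \<noteq> j"
      by auto
    have "\<omega> \<in> X (\<omega> (Suc m))"
      using *(2)[of "Suc m"] * by (auto simp: X_def)
    then show "\<omega> \<in> (\<Union>a. X a)" by blast
  next
    fix \<omega> assume "\<omega> \<in> (\<Union>a. X a)"
    then obtain a where \<omega>: "\<omega> \<in> X a" by blast
    then have "a \<noteq> j"
      by (auto simp: X_def)
    with \<omega> have a: "\<And>k. k \<le> Suc m \<Longrightarrow> \<omega> k = (x(Suc m := a)) k"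
      "\<And>k. k \<in> {Suc m<..Suc m + n} \<Longrightarrow> \<omega> k \<noteq> j"
      unfolding X_def if_not_P[OF \<open>a \<noteq> j\<close>] mem_Collect_eq by blast+
    have "\<omega> k \<noteq> j" if "k \<in> {m<..m + Suc n}" for k
      using \<open>a \<noteq> j\<close> a(1)[of "Suc m"] a(2)[of k] that by (cases "k = Suc m") auto
    with a(1) show "\<omega> \<in> {\<omega>. (\<forall>k\<le>m. \<omega> k = x k) \<and> (\<forall>k\<in>{m<..m + Suc n}. \<omega> k \<noteq> j)}"
      by auto
  qed
  moreover have "disjoint_family X"
    unfolding disjoint_family_on_def
  proof (intro ballI impI)
    fix a a' :: 'a assume "a \<noteq> a'"
    have "\<omega> (Suc m) = a" if "\<omega> \<in> X a" for \<omega> a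
      using that by (auto simp: X_def split: if_splits)
    with \<open>a \<noteq> a'\<close> show "X a \<inter> X a' = {}" by blast
  qed
  moreover have "X a \<in> sets (chain_law P i)" for a
  proof (cases "a = j")
    case False
    then show ?thesis
      unfolding X_def if_not_P[OF False] by (intro sets_chain_lawI[OF assms]) measurable
  qed (simp add: X_def)
  ultimately have "emeasure (chain_law P i) {\<omega>. (\<forall>k\<le>m. \<omega> k = x k) \<and> (\<forall>k\<in>{m<..m + Suc n}. \<omega> k \<noteq> j)} =
      nnsum (\<lambda>a. emeasure (chain_law P i) (X a))"
    by (simp add: emeasure_UN_countable)
  also have "\<dots> = nnsum (\<lambda>a. ?c * (ennreal (P (x m) a) * ((avoid P j n)(j := 0)) a))"
  proof (intro nn_integral_cong)
    fix a
    let ?x = "x(Suc m := a)"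
    have "(\<Prod>k<Suc m. P (?x k) (?x (Suc k))) = (\<Prod>k<m. P (x k) (x (Suc k))) * P (x m) a"
      by simp
    moreover have "0 \<le> (\<Prod>k<m. P (x k) (x (Suc k)))" "0 \<le> P (x m) a"
      using stochastic_nonneg[OF assms] by (auto intro: prod_nonneg)
    ultimately show "emeasure (chain_law P i) (X a) = ?c * (ennreal (P (x m) a) * ((avoid P j n)(j := 0)) a)"
      using Suc.IH[of "Suc m" ?x] by (simp add: X_def ennreal_mult mult.assoc)
  qed
  finally show ?case
    by (simp add: nnsum_cmult)
qed

lemma emeasure_chain_law_avoid:
  assumes "stochastic P"
  shows "emeasure (chain_law P i) {\<omega>. \<forall>k\<in>{0<..n}. \<omega> k \<noteq> j} = avoid P j n i"
proof -
  define X where "X a = {\<omega>. \<omega> 0 = a \<and> (\<forall>k\<in>{0<..n}. \<omega> k \<noteq> j)}" for a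
  have "X a \<in> sets (chain_law P i)" for a
    unfolding X_def by (rule sets_chain_lawI[OF assms]) measurable
  moreover have "disjoint_family X"
    by (auto simp: disjoint_family_on_def X_def)
  moreover have "{\<omega>. \<forall>k\<in>{0<..n}. \<omega> k \<noteq> j} = (\<Union>a. X a)"
    by (auto simp: X_def)
  ultimately have "emeasure (chain_law P i) {\<omega>. \<forall>k\<in>{0<..n}. \<omega> k \<noteq> j} =
      nnsum (\<lambda>a. emeasure (chain_law P i) (X a))"
    by (simp add: emeasure_UN_countable)
  also have "\<dots> = nnsum (\<lambda>a. avoid P j n i * indicator {i} a)"
    \<comment> \<open>With \<open>m = 0\<close> only \<open>x 0\<close> is prescribed, so a constant
      function serves as prefix.\<close>
    using emeasure_chain_law_prefix_avoid[OF assms, of i 0 _ n j, of "\<lambda>_. _"]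
    by (intro nn_integral_cong) (auto simp: X_def)
  finally show ?thesis
    by (simp add: nnsum_cmult)
qed

section \<open>Mean return times and positive recurrence\<close>

lemma less_return_time_iff: "enat n < return_time j \<omega> \<longleftrightarrow> (\<forall>k\<in>{0<..n}. \<omega> k \<noteq> j)"
proof
  assume less: "enat n < return_time j \<omega>"
  show "\<forall>k\<in>{0<..n}. \<omega> k \<noteq> j"
  proof (intro ballI notI)
    fix k assume "k \<in> {0<..n}" "\<omega> k = j"
    then have "return_time j \<omega> \<le> enat k"
      unfolding return_time_def by (intro INF_lower) auto
    with less have "enat n < enat k"
      by (rule order_less_le_trans)
    with \<open>k \<in> {0<..n}\<close> show False by simp
  qed
next
  assume *: "\<forall>k\<in>{0<..n}. \<omega> k \<noteq> j"
  have "enat (Suc n) \<le> return_time j \<omega>"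
    unfolding return_time_def
  proof (rule INF_greatest)
    fix k assume "k \<in> {k. 1 \<le> k \<and> \<omega> k = j}"
    with * show "enat (Suc n) \<le> enat k"
      by (cases "k \<le> n") auto
  qed
  then show "enat n < return_time j \<omega>"
    by (rule order_less_le_trans[rotated]) simp
qed

text \<open>As \<open>enat\<close> is countable, preimages of singletons suffice, and these are
  preimages under the measurable \<open>ennreal\<close> version because the embedding is
  injective.\<close>

lemma return_time_measurable:
  fixes P :: "'a::countable \<Rightarrow> 'a \<Rightarrow> real"
  assumes "stochastic P"
  shows "return_time j \<in> measurable (chain_law P i) (count_space UNIV)"
proof (subst measurable_count_space_eq_countable, simp, intro conjI ballI)
  fix t :: enat
  have "return_time j -` {t} \<inter> space (chain_law P i) =
      (\<lambda>\<omega>. ennreal_of_enat (return_time j \<omega>)) -` {ennreal_of_enat t} \<inter> space (chain_law P i)"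
    by auto
  also have "\<dots> \<in> sets (chain_law P i)"
    by (rule measurable_sets[OF measurable_return_time[OF assms]]) simp
  finally show "return_time j -` {t} \<inter> space (chain_law P i) \<in> sets (chain_law P i)" .
qed auto

text \<open>The tail formula: the mean of the return time is the sum over \<open>n\<close> of the
  probabilities that it exceeds \<open>n\<close>.\<close>

lemma mean_return_time:
  assumes "stochastic P"
  shows "(\<integral>\<^sup>+ \<omega>. ennreal_of_enat (return_time j \<omega>) \<partial>chain_law P i) = (\<Sum>n. avoid P j n i)"
  using nn_integral_enat_function[OF return_time_measurable[OF assms, of j i]]
  by (simp add: space_chain_law[OF assms] less_return_time_iff emeasure_chain_law_avoid[OF assms])

text \<open>Dropping the nonnegative remainder in \<open>invariant_avoid\<close> bounds all partial
  sums of the tail formula by \<open>1 / \<mu> j\<close>.\<close>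

lemma positive_recurrent_if_invariant:
  assumes "stochastic P" "irreducible_matrix P" "invariant_prob P \<mu>"
  shows "positive_recurrent P"
  unfolding positive_recurrent_def
proof
  fix j
  have pos: "0 < \<mu> j"
    by (rule invariant_prob_pos[OF assms])
  have "(\<Sum>n<N. avoid P j n j) \<le> ennreal (1 / \<mu> j)" for N
  proof -
    have "ennreal (\<mu> j) * (\<Sum>n<N. avoid P j n j) \<le> 1"
      unfolding invariant_avoid[OF assms(1,3), of j N, symmetric] by simp
    then have "ennreal (1 / \<mu> j) * (ennreal (\<mu> j) * (\<Sum>n<N. avoid P j n j)) \<le> ennreal (1 / \<mu> j) * 1"
      by (rule mult_left_mono) simp
    then show ?thesis
      using pos by (simp add: mult.assoc[symmetric] ennreal_mult[symmetric])
  qed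
  then have "(\<Sum>n. avoid P j n j) \<le> ennreal (1 / \<mu> j)"
    by (intro suminf_le_const) auto
  then show "(\<integral>\<^sup>+ \<omega>. ennreal_of_enat (return_time j \<omega>) \<partial>chain_law P j) < \<infinity>"
    by (simp add: mean_return_time[OF assms(1)] order_le_less_trans)
qed

section \<open>The perturbation bounds\<close>

text \<open>The reals \<open>D\<close>, \<open>E\<close>, \<open>M\<close> are upper bounds for the
  norms of \<open>\<Delta>\<close>, \<open>e\<close> and \<open>\<pi>\<close> rather than the norms
  themselves, so both parts of the theorem are instances.\<close>

lemma (in drift) perturbation_bound:
  fixes Pt :: "'a \<Rightarrow> 'a \<Rightarrow> real"
  assumes Pt: "stochastic Pt" "irreducible_matrix Pt"
    and \<pi>: "invariant_prob P \<pi>"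
    and \<Delta>: "\<And>i. nnsum (\<lambda>j. ennreal \<bar>Pt i j - P i j\<bar> * ennreal (V j)) \<le> ennreal (D * V i)"
    and "0 \<le> D" and E: "\<And>i. 1 \<le> E * V i"
    and M: "nnsum (\<lambda>i. ennreal (\<pi> i) * ennreal (V i)) \<le> ennreal M" "0 \<le> M"
    and small: "(1 + E * M) * D < 1 - lam"
  shows "positive_recurrent Pt \<and> (\<exists>\<nu>. unique_invariant_prob Pt \<nu> \<and>
    nnsum (\<lambda>i. ennreal \<bar>\<nu> i - \<pi> i\<bar> * ennreal (V i)) \<le>
      ennreal ((1 + E * M) * M * D / (1 - lam - (1 + E * M) * D)))"
proof -
  have E0: "0 < E"
    using E[of i0] V_pos[of i0] by (smt (verit) mult_nonpos_nonneg)
  have "0 \<le> E * M * D"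
    using E0 M \<open>0 \<le> D\<close> by simp
  then have "lam + D < 1"
    using small by (simp add: algebra_simps)
  have "drift Pt V i0 (lam + D) b eps"
  proof
    fix i
    have "nnsum (\<lambda>j. ennreal (Pt i j) * ennreal (V j)) \<le>
        nnsum (\<lambda>j. ennreal (P i j) * ennreal (V j) + ennreal \<bar>Pt i j - P i j\<bar> * ennreal (V j))"
    proof (rule nnsum_mono)
      fix j
      have "ennreal (Pt i j) \<le> ennreal (P i j) + ennreal \<bar>Pt i j - P i j\<bar>"
        using stochastic_nonneg[OF stoch, of i j]
        by (simp add: ennreal_plus[symmetric] ennreal_leI del: ennreal_plus)
      from mult_right_mono[OF this, of "ennreal (V j)"]
      show "ennreal (Pt i j) * ennreal (V j) \<le>
          ennreal (P i j) * ennreal (V j) + ennreal \<bar>Pt i j - P i j\<bar> * ennreal (V j)"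
        by (simp add: distrib_right)
    qed
    also have "\<dots> \<le> ennreal (lam * V i + b * indicator {i0} i) + ennreal (D * V i)"
      unfolding nnsum_add using drift \<Delta> by (intro add_mono)
    also have "\<dots> = ennreal ((lam + D) * V i + b * indicator {i0} i)"
      using lam b \<open>0 \<le> D\<close> V_pos[of i]
      by (subst ennreal_plus[symmetric]) (auto simp: algebra_simps)
    finally show "nnsum (\<lambda>j. ennreal (Pt i j) * ennreal (V j)) \<le>
      ennreal ((lam + D) * V i + b * indicator {i0} i)" .
  qed (use Pt eps V_ge lam b \<open>0 \<le> D\<close> \<open>lam + D < 1\<close> in auto)
  then interpret T: drift Pt V i0 "lam + D" b eps .
  obtain \<nu> where uniq: "unique_invariant_prob Pt \<nu>"
    and \<nu>V: "nnsum (\<lambda>i. ennreal (\<nu> i) * ennreal (V i)) < \<infinity>"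
    using T.unique_invariant by blast
  then have \<nu>: "invariant_prob Pt \<nu>"
    by (simp add: unique_invariant_prob_def)
  have \<nu>0: "0 \<le> \<nu> i" and \<pi>0: "0 \<le> \<pi> i" for i
    using \<nu> \<pi> by (auto simp: invariant_prob_def)
  have "0 < \<pi> i0"
    by (rule invariant_prob_pos[OF stoch irred \<pi>])
  define s where "s = (\<nu> i0 - \<pi> i0) / \<pi> i0"
  define \<rho> where "\<rho> i = \<nu> i - (1 + s) * \<pi> i" for i
  have \<rho>_i0: "\<rho> i0 = 0"
    using \<open>0 < \<pi> i0\<close> by (simp add: \<rho>_def s_def field_simps)
  \<comment> \<open>As \<open>enn2real\<close> maps \<open>\<infinity>\<close> to 0, these reals are
    the actual norms only once finiteness is known; for \<open>x\<close> and \<open>y\<close> it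
    comes from the domination bound \<open>dom\<close>.\<close>
  define n where "n = enn2real (nnsum (\<lambda>i. ennreal (\<nu> i) * ennreal (V i)))"
  define x where "x = enn2real (nnsum (\<lambda>i. ennreal \<bar>\<rho> i\<bar> * ennreal (V i)))"
  define y where "y = enn2real (nnsum (\<lambda>i. ennreal \<bar>\<nu> i - \<pi> i\<bar> * ennreal (V i)))"
  have nonneg: "0 \<le> n" "0 \<le> x" "0 \<le> y"
    by (simp_all add: n_def x_def y_def)
  have n: "nnsum (\<lambda>i. ennreal (\<nu> i) * ennreal (V i)) = ennreal n"
    using \<nu>V by (simp add: n_def)
  have dom: "nnsum (\<lambda>i. ennreal \<bar>f i\<bar> * ennreal (V i)) \<le> ennreal (p * n + q * M)"
    if "\<And>i. \<bar>f i\<bar> \<le> p * \<nu> i + q * \<pi> i" "0 \<le> p" "0 \<le> q" for f p q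
  proof -
    have "nnsum (\<lambda>i. ennreal \<bar>f i\<bar> * ennreal (V i)) \<le>
        nnsum (\<lambda>i. ennreal p * (ennreal (\<nu> i) * ennreal (V i)) + ennreal q * (ennreal (\<pi> i) * ennreal (V i)))"
    proof (rule nnsum_mono)
      fix i
      have "ennreal \<bar>f i\<bar> \<le> ennreal p * ennreal (\<nu> i) + ennreal q * ennreal (\<pi> i)"
        using that \<nu>0[of i] \<pi>0[of i]
        by (simp add: ennreal_mult[symmetric] ennreal_plus[symmetric] ennreal_leI del: ennreal_plus)
      from mult_right_mono[OF this, of "ennreal (V i)"]
      show "ennreal \<bar>f i\<bar> * ennreal (V i) \<le>
          ennreal p * (ennreal (\<nu> i) * ennreal (V i)) + ennreal q * (ennreal (\<pi> i) * ennreal (V i))"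
        by (simp add: distrib_right mult.assoc)
    qed
    also have "\<dots> \<le> ennreal p * ennreal n + ennreal q * ennreal M"
      unfolding nnsum_add nnsum_cmult n using M by (intro add_left_mono mult_left_mono) auto
    also have "\<dots> = ennreal (p * n + q * M)"
      using that nonneg M by (simp add: ennreal_mult)
    finally show ?thesis .
  qed
  have x: "nnsum (\<lambda>i. ennreal \<bar>\<rho> i\<bar> * ennreal (V i)) = ennreal x"
  proof -
    have "\<bar>\<rho> i\<bar> \<le> 1 * \<nu> i + \<bar>1 + s\<bar> * \<pi> i" for i
      using \<nu>0[of i] \<pi>0[of i] abs_triangle_ineq4[of "\<nu> i" "(1 + s) * \<pi> i"]
      by (simp add: \<rho>_def abs_mult)
    from dom[OF this] have "nnsum (\<lambda>i. ennreal \<bar>\<rho> i\<bar> * ennreal (V i)) < \<infinity>"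
      by (simp add: order_le_less_trans)
    then show ?thesis
      by (simp add: x_def)
  qed
  have y: "nnsum (\<lambda>i. ennreal \<bar>\<nu> i - \<pi> i\<bar> * ennreal (V i)) = ennreal y"
  proof -
    have "\<bar>\<nu> i - \<pi> i\<bar> \<le> 1 * \<nu> i + 1 * \<pi> i" for i
      using \<nu>0[of i] \<pi>0[of i] by simp
    from dom[OF this] have "nnsum (\<lambda>i. ennreal \<bar>\<nu> i - \<pi> i\<bar> * ennreal (V i)) < \<infinity>"
      by (simp add: order_le_less_trans)
    then show ?thesis
      by (simp add: y_def)
  qed
  have \<rho>_le: "ennreal \<bar>\<rho> j\<bar> \<le> nnsum (\<lambda>i. ennreal \<bar>\<rho> i\<bar> * ennreal (P i j)) +
      nnsum (\<lambda>i. ennreal (\<nu> i) * ennreal \<bar>Pt i j - P i j\<bar>)" for j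
  proof -
    \<comment> \<open>The difference of the two invariance equations; substituting
      \<open>\<nu> = \<rho> + (1 + s) \<pi>\<close> in the \<open>P\<close> part regroups it as
      \<open>\<rho> P + \<nu> \<Delta>\<close>.\<close>
    have "((\<lambda>i. \<nu> i * Pt i j - (1 + s) * (\<pi> i * P i j)) has_sum \<rho> j) UNIV"
      unfolding \<rho>_def using \<nu> \<pi>
      by (intro has_sum_diff has_sum_cmult_right) (auto simp: invariant_prob_def)
    then have "((\<lambda>i. \<rho> i * P i j + \<nu> i * (Pt i j - P i j)) has_sum \<rho> j) UNIV"
      by (simp add: \<rho>_def algebra_simps)
    then have "ennreal \<bar>\<rho> j\<bar> \<le> nnsum (\<lambda>i. ennreal \<bar>\<rho> i * P i j + \<nu> i * (Pt i j - P i j)\<bar>)"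
      by (rule has_sum_abs_le_nnsum)
    also have "\<dots> \<le> nnsum (\<lambda>i. ennreal \<bar>\<rho> i\<bar> * ennreal (P i j) + ennreal (\<nu> i) * ennreal \<bar>Pt i j - P i j\<bar>)"
    proof (rule nnsum_mono)
      fix i
      have "\<bar>\<rho> i * P i j + \<nu> i * (Pt i j - P i j)\<bar> \<le> \<bar>\<rho> i\<bar> * P i j + \<nu> i * \<bar>Pt i j - P i j\<bar>"
        using \<nu>0[of i] stochastic_nonneg[OF stoch, of i j]
          abs_triangle_ineq[of "\<rho> i * P i j" "\<nu> i * (Pt i j - P i j)"]
        by (simp add: abs_mult)
      from ennreal_leI[OF this]
      show "ennreal \<bar>\<rho> i * P i j + \<nu> i * (Pt i j - P i j)\<bar> \<le>
          ennreal \<bar>\<rho> i\<bar> * ennreal (P i j) + ennreal (\<nu> i) * ennreal \<bar>Pt i j - P i j\<bar>"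
        using \<nu>0[of i] stochastic_nonneg[OF stoch, of i j] by (simp add: ennreal_mult)
    qed
    finally show ?thesis
      by (simp only: nnsum_add)
  qed
  have "ennreal x \<le> nnsum (\<lambda>j. nnsum (\<lambda>i. ennreal \<bar>\<rho> i\<bar> * ennreal (P i j)) * ennreal (V j) +
      nnsum (\<lambda>i. ennreal (\<nu> i) * ennreal \<bar>Pt i j - P i j\<bar>) * ennreal (V j))"
    unfolding x[symmetric] distrib_right[symmetric]
    by (intro nnsum_mono mult_right_mono \<rho>_le) auto
  also have "\<dots> = nnsum (\<lambda>i. ennreal \<bar>\<rho> i\<bar> * nnsum (\<lambda>j. ennreal (P i j) * ennreal (V j))) +
      nnsum (\<lambda>i. ennreal (\<nu> i) * nnsum (\<lambda>j. ennreal \<bar>Pt i j - P i j\<bar> * ennreal (V j)))"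
    by (simp only: nnsum_add nnsum_kernel)
  also have "\<dots> \<le> nnsum (\<lambda>i. ennreal lam * (ennreal \<bar>\<rho> i\<bar> * ennreal (V i))) +
      nnsum (\<lambda>i. ennreal D * (ennreal (\<nu> i) * ennreal (V i)))"
  proof (intro add_mono nnsum_mono)
    fix i
    show "ennreal \<bar>\<rho> i\<bar> * nnsum (\<lambda>j. ennreal (P i j) * ennreal (V j)) \<le>
        ennreal lam * (ennreal \<bar>\<rho> i\<bar> * ennreal (V i))"
      using mult_left_mono[OF drift_off[of i], of "ennreal \<bar>\<rho> i\<bar>"] \<rho>_i0
      by (cases "i = i0") (auto simp: ac_simps)
    show "ennreal (\<nu> i) * nnsum (\<lambda>j. ennreal \<bar>Pt i j - P i j\<bar> * ennreal (V j)) \<le>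
        ennreal D * (ennreal (\<nu> i) * ennreal (V i))"
      using mult_left_mono[OF \<Delta>[of i], of "ennreal (\<nu> i)"] \<open>0 \<le> D\<close> V_pos[of i]
      by (simp add: ennreal_mult ac_simps)
  qed
  also have "\<dots> = ennreal (lam * x + D * n)"
    unfolding nnsum_cmult x n using nonneg lam \<open>0 \<le> D\<close> by (simp add: ennreal_mult)
  finally have x_le: "x \<le> lam * x + D * n"
    using nonneg lam \<open>0 \<le> D\<close> by (simp add: ennreal_plus[symmetric] del: ennreal_plus)
  have s_le: "\<bar>s\<bar> \<le> E * x"
  proof -
    have "(\<rho> has_sum 1 - (1 + s) * 1) UNIV"
      unfolding \<rho>_def using \<nu> \<pi>
      by (intro has_sum_diff has_sum_cmult_right) (auto simp: invariant_prob_def)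
    from has_sum_abs_le_nnsum[OF this] have "ennreal \<bar>s\<bar> \<le> nnsum (\<lambda>i. ennreal \<bar>\<rho> i\<bar>)"
      by simp
    also have "\<dots> \<le> nnsum (\<lambda>i. ennreal E * (ennreal \<bar>\<rho> i\<bar> * ennreal (V i)))"
    proof (rule nnsum_mono)
      fix i
      have "\<bar>\<rho> i\<bar> * 1 \<le> \<bar>\<rho> i\<bar> * (E * V i)"
        by (intro mult_left_mono E) simp
      from ennreal_leI[OF this]
      show "ennreal \<bar>\<rho> i\<bar> \<le> ennreal E * (ennreal \<bar>\<rho> i\<bar> * ennreal (V i))"
        using E0 V_pos[of i] by (simp add: ennreal_mult ac_simps)
    qed
    also have "\<dots> = ennreal (E * x)"
      unfolding nnsum_cmult x using nonneg E0 by (simp add: ennreal_mult)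
    finally show ?thesis
      using nonneg E0 by simp
  qed
  \<comment> \<open>From \<open>\<nu> - \<pi> = \<rho> + s \<pi>\<close>.\<close>
  have y_le: "y \<le> x + \<bar>s\<bar> * M"
  proof -
    have "ennreal y \<le> nnsum (\<lambda>i. ennreal \<bar>\<rho> i\<bar> * ennreal (V i) + ennreal \<bar>s\<bar> * (ennreal (\<pi> i) * ennreal (V i)))"
      unfolding y[symmetric]
    proof (rule nnsum_mono)
      fix i
      have "\<bar>\<nu> i - \<pi> i\<bar> \<le> \<bar>\<rho> i\<bar> + \<bar>s\<bar> * \<pi> i"
        using abs_triangle_ineq[of "\<rho> i" "s * \<pi> i"] \<pi>0[of i]
        by (simp add: \<rho>_def abs_mult algebra_simps)
      from mult_right_mono[OF ennreal_leI[OF this], of "ennreal (V i)"]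
      show "ennreal \<bar>\<nu> i - \<pi> i\<bar> * ennreal (V i) \<le>
          ennreal \<bar>\<rho> i\<bar> * ennreal (V i) + ennreal \<bar>s\<bar> * (ennreal (\<pi> i) * ennreal (V i))"
        using \<pi>0[of i] by (simp add: ennreal_mult distrib_right mult.assoc)
    qed
    also have "\<dots> \<le> ennreal x + ennreal \<bar>s\<bar> * ennreal M"
      unfolding nnsum_add nnsum_cmult x using M by (intro add_left_mono mult_left_mono) auto
    also have "\<dots> = ennreal (x + \<bar>s\<bar> * M)"
      using nonneg M by (simp add: ennreal_mult)
    finally show ?thesis
      using nonneg M by (simp add: ennreal_plus[symmetric] del: ennreal_plus)
  qed
  have n_le: "n \<le> M + y"
  proof -
    have "ennreal n \<le> nnsum (\<lambda>i. ennreal (\<pi> i) * ennreal (V i) + ennreal \<bar>\<nu> i - \<pi> i\<bar> * ennreal (V i))"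
      unfolding n[symmetric] distrib_right[symmetric]
    proof (intro nnsum_mono mult_right_mono)
      show "ennreal (\<nu> i) \<le> ennreal (\<pi> i) + ennreal \<bar>\<nu> i - \<pi> i\<bar>" for i
        using \<pi>0[of i] by (simp add: ennreal_plus[symmetric] ennreal_leI del: ennreal_plus)
    qed simp
    also have "\<dots> \<le> ennreal M + ennreal y"
      unfolding nnsum_add y using M by (intro add_right_mono)
    also have "\<dots> = ennreal (M + y)"
      using nonneg M by simp
    finally show ?thesis
      using nonneg M by (simp add: ennreal_plus[symmetric] del: ennreal_plus)
  qed
  define C where "C = 1 + E * M"
  have C: "0 < C"
    using E0 M by (simp add: C_def add_pos_nonneg)
  have "y \<le> C * x"
    using y_le mult_right_mono[OF s_le M(2)] by (simp add: C_def algebra_simps)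
  \<comment> \<open>The estimates close up to \<open>(1 - lam) * y \<le> C * D * (M + y)\<close>,
    and \<open>small\<close> makes the coefficient of \<open>y\<close> positive when
    solving.\<close>
  then have "(1 - lam) * y \<le> (1 - lam) * (C * x)"
    using lam by (intro mult_left_mono) auto
  also have "\<dots> = C * ((1 - lam) * x)"
    by simp
  also have "\<dots> \<le> C * (D * (M + y))"
    using C x_le mult_left_mono[OF n_le \<open>0 \<le> D\<close>] by (intro mult_left_mono) (auto simp: algebra_simps)
  finally have "y \<le> C * M * D / (1 - lam - C * D)"
    using small by (simp add: C_def[symmetric] pos_le_divide_eq) (simp add: algebra_simps)
  with uniq y show ?thesis
    using positive_recurrent_if_invariant[OF Pt \<nu>] by (auto simp: C_def ennreal_leI)
qed

section \<open>Translation of the V-norms into \<open>nnsum\<close>\<close>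

lemma mat_norm_le_imp:
  assumes "mat_norm V L \<le> ereal D" and "\<And>i. 0 < V i"
  shows "nnsum (\<lambda>j. ennreal \<bar>L i j\<bar> * ennreal (V j)) \<le> ennreal (D * V i)"
proof -
  have V: "0 \<le> V j" for j
    using assms(2)[of j] by simp
  let ?X = "nnsum (\<lambda>j. ennreal \<bar>L i j\<bar> * ennreal (V j))"
  have eq: "(\<Sum>\<^sub>\<infinity>j. ereal (\<bar>L i j\<bar> * V j)) = enn2ereal ?X"
    using infsum_ereal_eq_nnsum[of "\<lambda>j. \<bar>L i j\<bar> * V j"] V by (simp add: ennreal_mult)
  have "ereal (1 / V i) * (\<Sum>\<^sub>\<infinity>j. ereal (\<bar>L i j\<bar> * V j)) \<le> mat_norm V L"
    unfolding mat_norm_def by (rule SUP_upper) simp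
  also note assms(1)
  finally have le: "ereal (1 / V i) * enn2ereal ?X \<le> ereal D"
    unfolding eq .
  show ?thesis
  proof (cases ?X)
    case (real r)
    with le assms(2)[of i] show ?thesis
      by (auto simp: field_simps intro!: ennreal_leI)
  next
    case top
    with le assms(2)[of i] show ?thesis by simp
  qed
qed

lemma meas_norm_eq:
  assumes "\<And>i. 0 < V i"
  shows "meas_norm V \<mu> = enn2ereal (nnsum (\<lambda>i. ennreal \<bar>\<mu> i\<bar> * ennreal (V i)))"
  using infsum_ereal_eq_nnsum[of "\<lambda>i. \<bar>\<mu> i\<bar> * V i"] assms[THEN less_imp_le]
  by (simp add: meas_norm_def ennreal_mult)

lemma mat_norm_nonneg:
  assumes "\<And>i. 0 < V i"
  shows "0 \<le> mat_norm V L"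
proof -
  have "0 \<le> ereal (1 / V i) * (\<Sum>\<^sub>\<infinity>j. ereal (\<bar>L i j\<bar> * V j))" for i
    using assms[THEN less_imp_le]
    by (intro ereal_0_le_mult infsum_nonneg) auto
  then show ?thesis
    unfolding mat_norm_def by (rule SUP_upper2[rotated]) simp
qed

theorem corollary3p1:
  fixes P Pt :: "'a::countable \<Rightarrow> 'a \<Rightarrow> real"
    and \<pi> V :: "'a \<Rightarrow> real"
    and i0 :: 'a
    and lam b :: real
  defines "\<Delta> \<equiv> \<lambda>i j. Pt i j - P i j"
    and "c \<equiv> 1 + vec_norm V (\<lambda>_. 1) * meas_norm V \<pi>"
  assumes "stochastic P" and "irreducible_matrix P" and "positive_recurrent P"
    and "unique_invariant_prob P \<pi>"
    and "stochastic Pt" and "irreducible_matrix Pt"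
    and "0 < (INF i. ereal (V i))"
    and "0 < lam" and "lam < 1" and "0 < b"
    and "\<And>i. (\<Sum>\<^sub>\<infinity>j. ereal (P i j * V j)) \<le> ereal (lam * V i + b * indicator {i0} i)"
  shows
    "(mat_norm V \<Delta> < ereal (1 - lam) / c \<longrightarrow>
        positive_recurrent Pt \<and>
        (\<exists>\<nu>. unique_invariant_prob Pt \<nu> \<and>
          meas_norm V (\<lambda>i. \<nu> i - \<pi> i) \<le>
            c * meas_norm V \<pi> * mat_norm V \<Delta> / (ereal (1 - lam) - c * mat_norm V \<Delta>))) \<and>
     ((\<forall>i. 1 \<le> V i) \<and> mat_norm V \<Delta> < ereal ((1 - lam)\<^sup>2 / (b + 1 - lam)) \<longrightarrow>
        positive_recurrent Pt \<and>
        (\<exists>\<nu>. unique_invariant_prob Pt \<nu> \<and>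
          meas_norm V (\<lambda>i. \<nu> i - \<pi> i) \<le>
            ereal (b * (b + 1 - lam)) * mat_norm V \<Delta> /
              (ereal ((1 - lam) ^ 3) - ereal ((1 - lam) * (b + 1 - lam)) * mat_norm V \<Delta>)))"
proof -
  have INF_le: "(INF i. ereal (V i)) \<le> ereal (V i)" for i
    by (rule INF_lower) simp
  \<comment> \<open>The infimum is a real number: it is positive and at most
    \<open>V i0\<close>.\<close>
  obtain eps where eps: "(INF i. ereal (V i)) = ereal eps"
    using INF_le[of i0] assms(9) by (cases "INF i. ereal (V i)") auto
  then have eps0: "0 < eps" and V_ge: "eps \<le> V i" for i
    using INF_le[of i] assms(9) by auto
  have V_pos: "0 < V i" for i
    using eps0 V_ge[of i] by linarith
  have "drift P V i0 lam b eps"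
  proof
    fix i
    have "enn2ereal (nnsum (\<lambda>j. ennreal (P i j) * ennreal (V j))) = (\<Sum>\<^sub>\<infinity>j. ereal (P i j * V j))"
      using infsum_ereal_eq_nnsum[of "\<lambda>j. P i j * V j"] stochastic_nonneg[OF assms(3)] V_pos[THEN less_imp_le]
      by (simp add: ennreal_mult)
    also have "\<dots> \<le> enn2ereal (ennreal (lam * V i + b * indicator {i0} i))"
    proof -
      have "0 \<le> lam * V i + b * indicator {i0} i"
        using V_pos[of i] assms(10,12) by simp
      then show ?thesis
        using assms(13)[of i] by (simp only: enn2ereal_ennreal)
    qed
    finally show "nnsum (\<lambda>j. ennreal (P i j) * ennreal (V j)) \<le> ennreal (lam * V i + b * indicator {i0} i)"
      by (simp only: less_eq_ennreal.rep_eq)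
  qed (use assms eps0 V_ge in auto)
  then interpret drift P V i0 lam b eps .
  have \<pi>: "invariant_prob P \<pi>"
    using assms(6) by (simp add: unique_invariant_prob_def)
  then have "\<bar>\<pi> i\<bar> = \<pi> i" for i
    by (simp add: invariant_prob_def)
  then obtain M where M: "nnsum (\<lambda>i. ennreal (\<pi> i) * ennreal (V i)) = ennreal M" "0 \<le> M"
    and M': "meas_norm V \<pi> = ereal M"
    using invariant_V_finite[OF \<pi>] meas_norm_eq[of V \<pi>, OF V_pos]
    by (cases "nnsum (\<lambda>i. ennreal (\<pi> i) * ennreal (V i))") auto
  have "ereal (1 / V i) \<le> vec_norm V (\<lambda>_. 1)" for i
    unfolding vec_norm_def by (rule SUP_upper2[of i]) auto
  \<comment> \<open>Finiteness of the norm of \<open>e\<close>, from the lower bound on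
    \<open>V\<close>.\<close>
  moreover have "vec_norm V (\<lambda>_. 1) \<le> ereal (1 / eps)"
    unfolding vec_norm_def using eps0 V_ge V_pos
    by (intro SUP_least) (simp add: frac_le)
  ultimately obtain E where E': "vec_norm V (\<lambda>_. 1) = ereal E" and E: "1 / V i \<le> E" for i
    by (cases "vec_norm V (\<lambda>_. 1)") auto
  have E1: "1 \<le> E * V i" for i
    using E[of i] V_pos[of i] by (simp add: field_simps)
  have "0 \<le> E"
    using E[of i0] V_pos[of i0] by (meson divide_nonneg_pos order_trans zero_le_one)
  have c: "c = ereal (1 + E * M)"
    by (simp add: c_def E' M')
  have c0: "0 < 1 + E * M"
    using \<open>0 \<le> E\<close> M by (simp add: add_pos_nonneg)
  have D_ex: "\<exists>D. mat_norm V \<Delta> = ereal D \<and> 0 \<le> D \<and> D < B" if "mat_norm V \<Delta> < ereal B" for B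
    using that mat_norm_nonneg[of V \<Delta>, OF V_pos] by (cases "mat_norm V \<Delta>") auto
  \<comment> \<open>\<open>perturbation_bound\<close> with its conclusion in \<open>ereal\<close>.
    Part (i) takes the exact norms as constants, part (ii) takes 1 and
    \<open>b / (1 - lam)\<close>.\<close>
  have main: "positive_recurrent Pt \<and> (\<exists>\<nu>. unique_invariant_prob Pt \<nu> \<and>
      meas_norm V (\<lambda>i. \<nu> i - \<pi> i) \<le> ereal ((1 + E' * M') * M' * D / (1 - lam - (1 + E' * M') * D)))"
    if D: "mat_norm V \<Delta> = ereal D" "0 \<le> D" and E': "\<And>i. 1 \<le> E' * V i" "0 \<le> E'"
      and M': "nnsum (\<lambda>i. ennreal (\<pi> i) * ennreal (V i)) \<le> ennreal M'" "0 \<le> M'"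
      and small: "(1 + E' * M') * D < 1 - lam" for D E' M'
  proof -
    let ?B = "(1 + E' * M') * M' * D / (1 - lam - (1 + E' * M') * D)"
    have "0 \<le> ?B"
      using D E' M' small by simp
    have "nnsum (\<lambda>j. ennreal \<bar>Pt i j - P i j\<bar> * ennreal (V j)) \<le> ennreal (D * V i)" for i
      using mat_norm_le_imp[of V \<Delta> D, OF _ V_pos, of i] D by (simp add: \<Delta>_def)
    from perturbation_bound[OF assms(7,8) \<pi> this D(2) E'(1) M' small]
    obtain \<nu> where "positive_recurrent Pt" "unique_invariant_prob Pt \<nu>"
      and "nnsum (\<lambda>i. ennreal \<bar>\<nu> i - \<pi> i\<bar> * ennreal (V i)) \<le> ennreal ?B"
      by blast
    then have "meas_norm V (\<lambda>i. \<nu> i - \<pi> i) \<le> enn2ereal (ennreal ?B)"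
      unfolding meas_norm_eq[of V, OF V_pos] by (simp only: less_eq_ennreal.rep_eq)
    then have "meas_norm V (\<lambda>i. \<nu> i - \<pi> i) \<le> ereal ?B"
      unfolding enn2ereal_ennreal[OF \<open>0 \<le> ?B\<close>] .
    with \<open>positive_recurrent Pt\<close> \<open>unique_invariant_prob Pt \<nu>\<close> show ?thesis
      by blast
  qed
  show ?thesis
  proof (intro conjI[of "_ \<longrightarrow> _"] impI)
    assume "mat_norm V \<Delta> < ereal (1 - lam) / c"
    then have "mat_norm V \<Delta> < ereal ((1 - lam) / (1 + E * M))"
      using c0 by (simp add: c)
    then obtain D where D: "mat_norm V \<Delta> = ereal D" "0 \<le> D" and "D < (1 - lam) / (1 + E * M)"
      using D_ex by blast
    then have small: "(1 + E * M) * D < 1 - lam"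
      using c0 by (simp add: pos_less_divide_eq mult.commute)
    \<comment> \<open>By \<open>small\<close> the denominator is nonzero, so the extended-real
      quotient is the real one.\<close>
    from small main[OF D E1 \<open>0 \<le> E\<close> eq_refl[OF M(1)] M(2) small]
    show "positive_recurrent Pt \<and> (\<exists>\<nu>. unique_invariant_prob Pt \<nu> \<and>
          meas_norm V (\<lambda>i. \<nu> i - \<pi> i) \<le>
            c * meas_norm V \<pi> * mat_norm V \<Delta> / (ereal (1 - lam) - c * mat_norm V \<Delta>))"
      by (simp add: c M' D)
  next
    assume asm: "(\<forall>i. 1 \<le> V i) \<and> mat_norm V \<Delta> < ereal ((1 - lam)\<^sup>2 / (b + 1 - lam))"
    then obtain D where D: "mat_norm V \<Delta> = ereal D" "0 \<le> D" and D_less: "D < (1 - lam)\<^sup>2 / (b + 1 - lam)"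
      using D_ex by blast
    \<comment> \<open>With constants 1 and \<open>b / t\<close> the factor \<open>c\<close> becomes
      \<open>(b + t) / t\<close>, and \<open>t / c\<close> is the threshold assumed in (ii).\<close>
    define t where "t = 1 - lam"
    have t: "0 < t" "0 < b + t"
      using lam b by (auto simp: t_def)
    have bt: "b + 1 - lam = b + t"
      by (simp add: t_def)
    have small': "(b + t) * D < t\<^sup>2"
      using D_less t unfolding bt by (simp add: t_def[symmetric] pos_less_divide_eq mult.commute)
    then have small: "(1 + 1 * (b / (1 - lam))) * D < 1 - lam"
      using t unfolding t_def[symmetric] by (simp add: field_simps power2_eq_square)
    \<comment> \<open>Numerator and denominator are both multiplied by
      \<open>t\<^sup>2\<close>.\<close>
    have "(1 + 1 * (b / t)) * (b / t) * D / (t - (1 + 1 * (b / t)) * D) = b * (b + t) * D / (t ^ 3 - t * (b + t) * D)"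
    proof -
      have "(1 + 1 * (b / t)) * (b / t) * D = b * (b + t) * D / t\<^sup>2"
        using t by (simp add: field_simps power2_eq_square)
      moreover have "t - (1 + 1 * (b / t)) * D = (t ^ 3 - t * (b + t) * D) / t\<^sup>2"
        using t by (simp add: field_simps power2_eq_square power3_eq_cube)
      ultimately show ?thesis
        using t by simp
    qed
    \<comment> \<open>Needed because in \<open>ereal\<close> the inverse of 0 is
      \<open>\<infinity>\<close>, so its division agrees with real division only for a nonzero
      denominator.\<close>
    moreover have "t ^ 3 - t * (b + t) * D \<noteq> 0"
    proof -
      have "t ^ 3 - t * (b + t) * D = t * (t\<^sup>2 - (b + t) * D)"
        by (simp add: power2_eq_square power3_eq_cube algebra_simps)
      then show ?thesis
        using small' t by simp
    qed
    moreover have "positive_recurrent Pt \<and> (\<exists>\<nu>. unique_invariant_prob Pt \<nu> \<and>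
      meas_norm V (\<lambda>i. \<nu> i - \<pi> i) \<le> ereal ((1 + 1 * (b / t)) * (b / t) * D / (t - (1 + 1 * (b / t)) * D)))"
      unfolding t_def using main[OF D, of 1 "b / (1 - lam)", OF _ _ invariant_V_le[OF \<pi>] _ small] asm lam b by simp
    ultimately show "positive_recurrent Pt \<and> (\<exists>\<nu>. unique_invariant_prob Pt \<nu> \<and>
          meas_norm V (\<lambda>i. \<nu> i - \<pi> i) \<le>
            ereal (b * (b + 1 - lam)) * mat_norm V \<Delta> /
              (ereal ((1 - lam) ^ 3) - ereal ((1 - lam) * (b + 1 - lam)) * mat_norm V \<Delta>))"
      unfolding bt t_def[symmetric] D by simp
  qed
qed

end
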